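(* Let $T,m,n\ge1$ be integers, $1\le p<\infty$, $\gamma>0$, $c>0$, $\varepsilon>0$, and let $C$, $\bar\mu$, $\tilde\mu$ be the cost tensor and marginals defined in the context from a collection of $m$ trajectories $\mathbf{X}$ and a collection of $n$ trajectories $\mathbf{Y}$. Consider the dual problem $$\max_{\bar\lambda^t\in\mathbb{R}^{m+1},\ \tilde\lambda^t\in\mathbb{R}^{n+1},\ t=1,\dots,T}\ \phi(\bar\lambda,\tilde\lambda),$$ $$\phi(\bar\lambda,\tilde\lambda)=-\varepsilon\sum_{(i_1,j_1),\dots,(i_T,j_T)}M^{(\bar\lambda,\tilde\lambda)}_{(i_1,j_1),\dots,(i_T,j_T)}+\sum_{t=1}^T\sum_{i=1}^{m+1}\bar\mu_i\bar\lambda_i^t+\sum_{t=1}^T\sum_{j=1}^{n+1}\tilde\mu_j\tilde\lambda_j^t+\varepsilon(m+1)^T(n+1)^T,$$ $$M^{(\bar\lambda,\tilde\lambda)}_{(i_1,j_1),\dots,(i_T,j_T)}=\exp\!\left(-\frac{C_{(i_1,j_1),\dots,(i_T,j_T)}}{\varepsilon}\right)\prod_{t=1}^T\exp\!\left(\frac{\bar\lambda^t_{i_t}}{\varepsilon}\right)\prod_{t=1}^T\exp\!\left(\frac{\tilde\lambda^t_{j_t}}{\varepsilon}\right).$$ Let $(\bar\lambda^{[r]},\tilde\lambda^{[r]})_{r\ge0}$ be the sequence of dual variables produced by the Block Coordinate Ascent Algorithm described in the context (run without stopping, $r$ counting full passes of the main loop). Then $(\bar\lambda^{[r]},\tilde\lambda^{[r]})$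 converges linearly to an optimal solution of the dual problem, i.e., there are an optimal solution $(\bar\lambda^*,\tilde\lambda^* )$ and constants $A\ge0$, $\rho\in[0,1)$ with $\|(\bar\lambda^{[r]},\tilde\lambda^{[r]})-(\bar\lambda^*,\tilde\lambda^* )\|\le A\rho^r$ for all $r\ge0$.
   Context: Trajectories: a trajectory on time steps $\{1,\dots,T\}$ is a sequence $(\boldsymbol{x}^1,\dots,\boldsymbol{x}^T)$ of sets, where each $\boldsymbol{x}^t$ is either $\{x^t\}$ with $x^t\in\mathbb{R}^N$ or $\varnothing$. $\boldsymbol{x}_i^t$ ($i\le m$) and $\boldsymbol{y}_j^t$ ($j\le n$) are the states at time $t$ of the $i$-th trajectory of $\mathbf{X}$ and the $j$-th trajectory of $\mathbf{Y}$; $\boldsymbol{x}_{m+1}^t=\boldsymbol{y}_{n+1}^t=\varnothing$ for all $t$. For $i=1,\dots,m+1$, $j=1,\dots,n+1$: $(D^t_{(i,j)})^{1/p}=\min(\|x_i^t-y_j^t\|,c)$ if $\boldsymbol{x}_i^t=\{x_i^t\}$ and $\boldsymbol{y}_j^t=\{y_j^t\}$; $(D^t_{(i,j)})^{1/p}=0$ if $\boldsymbol{x}_i^t=\boldsymbol{y}_j^t=\varnothing$; $(D^t_{(i,j)})^{1/p}=c/2^{1/p}$ otherwise, where $\|\cdot\|$ is the norm on $\mathbb{R}^N$. For $i,k\in\{1,\dots,m+1\}$, $j,l\in\{1,\dots,n+1\}$: $F_{(i,j),(k,l)}=\frac{\gamma^p}{2}(1-\delta_{ik}\delta_{jl})\big((1-\delta_{k,m+1})(1-\delta_{l,n+1})+(1-\delta_{i,m+1})(1-\delta_{j,n+1})\big)$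 if $i=k$, and $F_{(i,j),(k,l)}=\infty$ otherwise ($\delta$ is the Kronecker delta). Convention: $\exp(-\infty)=0$. $C_{(i_1,j_1),\dots,(i_T,j_T)}=\sum_{t=1}^T D^t_{(i_t,j_t)}+\sum_{t=1}^{T-1}F_{(i_t,j_t),(i_{t+1},j_{t+1})}$ for $i_t\in\{1,\dots,m+1\}$, $j_t\in\{1,\dots,n+1\}$; $\bar\mu=(\mathbf{1}_m^\top,n)^\top\in\mathbb{R}^{m+1}$, $\tilde\mu=(\mathbf{1}_n^\top,m)^\top\in\mathbb{R}^{n+1}$, with $\mathbf{1}_\ell\in\mathbb{R}^\ell$ the all-ones vector. For a tensor $M$ with entries $M_{(i_1,j_1),\dots,(i_T,j_T)}$, $P_t(M)$ is the $(m+1)\times(n+1)$ matrix with $P_t(M)_{(i_t,j_t)}$ equal to the sum of $M_{(i_1,j_1),\dots,(i_T,j_T)}$ over all index pairs except $(i_t,j_t)$. Transformed variables: $\bar u^t=\exp(\bar\lambda^t/\varepsilon)$, $\tilde u^t=\exp(\tilde\lambda^t/\varepsilon)$ elementwise (so $\bar\lambda^t=\varepsilon\log\bar u^t$, $\tilde\lambda^t=\varepsilon\log\tilde u^t$). $\oslash$ and $\odot$ denote elementwise division and multiplication. Put $k^t_{(i,j)}=\exp(-D^t_{(i,j)}/\varepsilon)$ and $\hat k_{(i,j),(k,l)}=\exp(-F_{(i,j),(k,l)}/\varepsilon)$. Block Coordinate Ascent Algorithm. Initialize all entries of all $\bar u^t$ and $\tilde u^t$ to one. Then repeat the following pass: (1)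 Set $\overleftarrow{\Phi}^T\equiv1$; for $t=T-1,\dots,1$ set $\overleftarrow{\Phi}^t_{(i,j)}=\sum_{(k,l)}\overleftarrow{\Phi}^{t+1}_{(k,l)}k^{t+1}_{(k,l)}\hat k_{(i,j),(k,l)}\bar u^{t+1}_k\tilde u^{t+1}_l$. (2) Set $\overrightarrow{\Phi}^1\equiv1$. (3) For $t=1,\dots,T$, in order: first update $\bar u^t\leftarrow\bar\mu\oslash(P_t\mathbf{1}_{n+1})\odot\bar u^t$; then update $\tilde u^t\leftarrow\tilde\mu\oslash(P_t^\top\mathbf{1}_{m+1})\odot\tilde u^t$; then, if $t<T$, set $\overrightarrow{\Phi}^{t+1}_{(i,j)}=\sum_{(k,l)}\overrightarrow{\Phi}^{t}_{(k,l)}k^{t}_{(k,l)}\hat k_{(k,l),(i,j)}\bar u^{t}_k\tilde u^{t}_l$. Here, at each update, $P_t=P_t(M^{(\bar\lambda,\tilde\lambda)})$ for the current values of the variables, computed as $(P_t)_{(i,j)}=\overrightarrow{\Phi}^t_{(i,j)}k^t_{(i,j)}\bar u^t_i\tilde u^t_j\overleftarrow{\Phi}^t_{(i,j)}$. The expression $a\oslash b\odot u$ is read as $(a\oslash b)\odot u$. *)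

theory Defs
  imports "HOL-Analysis.Analysis"
begin

(* A state is None (the empty set) or Some x (the singleton {x}); X i t is the state of the
   i-th trajectory at time t.  Trajectories are numbered from 1 and times run through {1..T};
   values of X, and of all the vectors and tensors below, outside these index ranges are
   irrelevant. *)

type_synonym 'a trajectories = "nat \<Rightarrow> nat \<Rightarrow> 'a option"

(* The auxiliary trajectory m + 1 is empty at all times. *)
definition traj_state :: "nat \<Rightarrow> 'a trajectories \<Rightarrow> nat \<Rightarrow> nat \<Rightarrow> 'a option" where
  "traj_state m X i t = (if i \<in> {1..m} then X i t else None)"

definition pair_indices :: "nat \<Rightarrow> nat \<Rightarrow> (nat \<times> nat) set" where
  "pair_indices m n = {1..m+1} \<times> {1..n+1}"

definition tensor_indices :: "nat \<Rightarrow> nat \<Rightarrow> nat \<Rightarrow> (nat \<Rightarrow> nat \<times> nat) set" where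
  "tensor_indices T m n = (\<Pi>\<^sub>E t\<in>{1..T}. pair_indices m n)"

fun state_dist :: "real \<Rightarrow> real \<Rightarrow> ('a::real_normed_vector) option \<Rightarrow> 'a option \<Rightarrow> real" where
  "state_dist p c (Some x) (Some y) = min (norm (x - y)) c"
| "state_dist p c None None = 0"
| "state_dist p c _ _ = c / 2 powr (1 / p)"

fun D_cost :: "nat \<Rightarrow> nat \<Rightarrow> real \<Rightarrow> real \<Rightarrow> ('a::real_normed_vector) trajectories \<Rightarrow> 'a trajectories
    \<Rightarrow> nat \<Rightarrow> nat \<times> nat \<Rightarrow> real" where
  "D_cost m n p c X Y t (i, j) = state_dist p c (traj_state m X i t) (traj_state n Y j t) powr p"

fun F_cost :: "nat \<Rightarrow> nat \<Rightarrow> real \<Rightarrow> real \<Rightarrow> nat \<times> nat \<Rightarrow> nat \<times> nat \<Rightarrow> ereal" where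
  "F_cost m n p \<gamma> (i, j) (k, l) =
     (if i = k
      then ereal (\<gamma> powr p / 2 * (1 - of_bool (i = k) * of_bool (j = l)) *
             ((1 - of_bool (k = m + 1)) * (1 - of_bool (l = n + 1)) +
              (1 - of_bool (i = m + 1)) * (1 - of_bool (j = n + 1))))
      else \<infinity>)"

definition C_cost :: "nat \<Rightarrow> nat \<Rightarrow> nat \<Rightarrow> real \<Rightarrow> real \<Rightarrow> real
    \<Rightarrow> ('a::real_normed_vector) trajectories \<Rightarrow> 'a trajectories \<Rightarrow> (nat \<Rightarrow> nat \<times> nat) \<Rightarrow> ereal" where
  "C_cost T m n p \<gamma> c X Y s =
     (\<Sum>t=1..T. ereal (D_cost m n p c X Y t (s t))) + (\<Sum>t=1..<T. F_cost m n p \<gamma> (s t) (s (t + 1)))"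

definition mu_bar :: "nat \<Rightarrow> nat \<Rightarrow> nat \<Rightarrow> real" where
  "mu_bar m n i = (if i \<le> m then 1 else real n)"

definition mu_tilde :: "nat \<Rightarrow> nat \<Rightarrow> nat \<Rightarrow> real" where
  "mu_tilde m n j = (if j \<le> n then 1 else real m)"

(* The exponential with exp (-\<infinity>) = 0; the value at \<infinity> is never used. *)
definition exp_ereal :: "ereal \<Rightarrow> real" where
  "exp_ereal x = (if x = -\<infinity> then 0 else exp (real_of_ereal x))"

(* Dual variables: la t i is the i-th entry of the row multiplier at time t, lb t j the j-th
   entry of the column multiplier. *)

definition M_tensor :: "nat \<Rightarrow> nat \<Rightarrow> nat \<Rightarrow> real \<Rightarrow> real \<Rightarrow> real \<Rightarrow> real
    \<Rightarrow> ('a::real_normed_vector) trajectories \<Rightarrow> 'a trajectories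
    \<Rightarrow> (nat \<Rightarrow> nat \<Rightarrow> real) \<Rightarrow> (nat \<Rightarrow> nat \<Rightarrow> real) \<Rightarrow> (nat \<Rightarrow> nat \<times> nat) \<Rightarrow> real" where
  "M_tensor T m n p \<gamma> c \<epsilon> X Y la lb s =
     exp_ereal (- C_cost T m n p \<gamma> c X Y s / ereal \<epsilon>)
       * (\<Prod>t=1..T. exp (la t (fst (s t)) / \<epsilon>)) * (\<Prod>t=1..T. exp (lb t (snd (s t)) / \<epsilon>))"

definition dual_objective :: "nat \<Rightarrow> nat \<Rightarrow> nat \<Rightarrow> real \<Rightarrow> real \<Rightarrow> real \<Rightarrow> real
    \<Rightarrow> ('a::real_normed_vector) trajectories \<Rightarrow> 'a trajectories
    \<Rightarrow> (nat \<Rightarrow> nat \<Rightarrow> real) \<Rightarrow> (nat \<Rightarrow> nat \<Rightarrow> real) \<Rightarrow> real" where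
  "dual_objective T m n p \<gamma> c \<epsilon> X Y la lb =
     - \<epsilon> * (\<Sum>s\<in>tensor_indices T m n. M_tensor T m n p \<gamma> c \<epsilon> X Y la lb s)
     + (\<Sum>t=1..T. \<Sum>i=1..m+1. mu_bar m n i * la t i)
     + (\<Sum>t=1..T. \<Sum>j=1..n+1. mu_tilde m n j * lb t j)
     + \<epsilon> * real (m + 1) ^ T * real (n + 1) ^ T"

definition dual_optimal :: "nat \<Rightarrow> nat \<Rightarrow> nat \<Rightarrow> real \<Rightarrow> real \<Rightarrow> real \<Rightarrow> real
    \<Rightarrow> ('a::real_normed_vector) trajectories \<Rightarrow> 'a trajectories
    \<Rightarrow> (nat \<Rightarrow> nat \<Rightarrow> real) \<Rightarrow> (nat \<Rightarrow> nat \<Rightarrow> real) \<Rightarrow> bool" where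
  "dual_optimal T m n p \<gamma> c \<epsilon> X Y la lb \<longleftrightarrow>
     (\<forall>la' lb'. dual_objective T m n p \<gamma> c \<epsilon> X Y la' lb' \<le> dual_objective T m n p \<gamma> c \<epsilon> X Y la lb)"

(* Euclidean norm on the T(m+1) + T(n+1) dual coordinates. *)
definition dual_norm :: "nat \<Rightarrow> nat \<Rightarrow> nat \<Rightarrow> (nat \<Rightarrow> nat \<Rightarrow> real) \<Rightarrow> (nat \<Rightarrow> nat \<Rightarrow> real) \<Rightarrow> real" where
  "dual_norm T m n la lb =
     sqrt ((\<Sum>t=1..T. \<Sum>i=1..m+1. (la t i)\<^sup>2) + (\<Sum>t=1..T. \<Sum>j=1..n+1. (lb t j)\<^sup>2))"

(* The algorithm, for arbitrary marginals a, b and arbitrary kernels k (single time) and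
   kh (transition); u and v are the exponentials of the row and column multipliers
   divided by \<epsilon>. *)

(* back_msg T m n k kh u v d is the backward message at time T - d. *)
primrec back_msg :: "nat \<Rightarrow> nat \<Rightarrow> nat \<Rightarrow> (nat \<Rightarrow> nat \<times> nat \<Rightarrow> real) \<Rightarrow> (nat \<times> nat \<Rightarrow> nat \<times> nat \<Rightarrow> real)
    \<Rightarrow> (nat \<Rightarrow> nat \<Rightarrow> real) \<Rightarrow> (nat \<Rightarrow> nat \<Rightarrow> real) \<Rightarrow> nat \<Rightarrow> nat \<times> nat \<Rightarrow> real" where
  "back_msg T m n k kh u v 0 = (\<lambda>_. 1)"
| "back_msg T m n k kh u v (Suc d) = (\<lambda>q. \<Sum>r\<in>pair_indices m n.
     back_msg T m n k kh u v d r * k (T - d) r * kh q r * u (T - d) (fst r) * v (T - d) (snd r))"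

definition P_mat :: "(nat \<times> nat \<Rightarrow> real) \<Rightarrow> (nat \<times> nat \<Rightarrow> real) \<Rightarrow> (nat \<times> nat \<Rightarrow> real)
    \<Rightarrow> (nat \<Rightarrow> real) \<Rightarrow> (nat \<Rightarrow> real) \<Rightarrow> nat \<Rightarrow> nat \<Rightarrow> real" where
  "P_mat fw kt bw ut vt i j = fw (i, j) * kt (i, j) * ut i * vt j * bw (i, j)"

(* The loop state is (u, v, fw) with fw the forward message at the current time t; the backward
   messages bw are those computed at the start of the pass. *)
definition time_step :: "nat \<Rightarrow> nat \<Rightarrow> nat \<Rightarrow> (nat \<Rightarrow> real) \<Rightarrow> (nat \<Rightarrow> real)
    \<Rightarrow> (nat \<Rightarrow> nat \<times> nat \<Rightarrow> real) \<Rightarrow> (nat \<times> nat \<Rightarrow> nat \<times> nat \<Rightarrow> real) \<Rightarrow> (nat \<Rightarrow> nat \<times> nat \<Rightarrow> real) \<Rightarrow> nat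
    \<Rightarrow> (nat \<Rightarrow> nat \<Rightarrow> real) \<times> (nat \<Rightarrow> nat \<Rightarrow> real) \<times> (nat \<times> nat \<Rightarrow> real)
    \<Rightarrow> (nat \<Rightarrow> nat \<Rightarrow> real) \<times> (nat \<Rightarrow> nat \<Rightarrow> real) \<times> (nat \<times> nat \<Rightarrow> real)" where
  "time_step T m n a b k kh bw t = (\<lambda>(u, v, fw).
     let u' = u(t := (\<lambda>i. a i / (\<Sum>j=1..n+1. P_mat fw (k t) (bw t) (u t) (v t) i j) * u t i));
         v' = v(t := (\<lambda>j. b j / (\<Sum>i=1..m+1. P_mat fw (k t) (bw t) (u' t) (v t) i j) * v t j));
         fw' = (if t < T
                then (\<lambda>q. \<Sum>r\<in>pair_indices m n. fw r * k t r * kh r q * u' t (fst r) * v' t (snd r))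
                else fw)
     in (u', v', fw'))"

definition bca_pass :: "nat \<Rightarrow> nat \<Rightarrow> nat \<Rightarrow> (nat \<Rightarrow> real) \<Rightarrow> (nat \<Rightarrow> real)
    \<Rightarrow> (nat \<Rightarrow> nat \<times> nat \<Rightarrow> real) \<Rightarrow> (nat \<times> nat \<Rightarrow> nat \<times> nat \<Rightarrow> real)
    \<Rightarrow> (nat \<Rightarrow> nat \<Rightarrow> real) \<times> (nat \<Rightarrow> nat \<Rightarrow> real) \<Rightarrow> (nat \<Rightarrow> nat \<Rightarrow> real) \<times> (nat \<Rightarrow> nat \<Rightarrow> real)" where
  "bca_pass T m n a b k kh = (\<lambda>(u, v).
     let bw = (\<lambda>t. back_msg T m n k kh u v (T - t));
         (u', v', _) = fold (time_step T m n a b k kh bw) [1..<T+1] (u, v, \<lambda>_. 1)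
     in (u', v'))"

definition bca_iterate :: "nat \<Rightarrow> nat \<Rightarrow> nat \<Rightarrow> real \<Rightarrow> real \<Rightarrow> real \<Rightarrow> real
    \<Rightarrow> ('a::real_normed_vector) trajectories \<Rightarrow> 'a trajectories
    \<Rightarrow> nat \<Rightarrow> (nat \<Rightarrow> nat \<Rightarrow> real) \<times> (nat \<Rightarrow> nat \<Rightarrow> real)" where
  "bca_iterate T m n p \<gamma> c \<epsilon> X Y r =
     (bca_pass T m n (mu_bar m n) (mu_tilde m n)
        (\<lambda>t q. exp (- D_cost m n p c X Y t q / \<epsilon>))
        (\<lambda>q q'. exp_ereal (- F_cost m n p \<gamma> q q' / ereal \<epsilon>)) ^^ r)
       (\<lambda>_ _. 1, \<lambda>_ _. 1)"

definition bca_lambda_bar :: "nat \<Rightarrow> nat \<Rightarrow> nat \<Rightarrow> real \<Rightarrow> real \<Rightarrow> real \<Rightarrow> real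
    \<Rightarrow> ('a::real_normed_vector) trajectories \<Rightarrow> 'a trajectories \<Rightarrow> nat \<Rightarrow> nat \<Rightarrow> nat \<Rightarrow> real" where
  "bca_lambda_bar T m n p \<gamma> c \<epsilon> X Y r t i = \<epsilon> * ln (fst (bca_iterate T m n p \<gamma> c \<epsilon> X Y r) t i)"

definition bca_lambda_tilde :: "nat \<Rightarrow> nat \<Rightarrow> nat \<Rightarrow> real \<Rightarrow> real \<Rightarrow> real \<Rightarrow> real
    \<Rightarrow> ('a::real_normed_vector) trajectories \<Rightarrow> 'a trajectories \<Rightarrow> nat \<Rightarrow> nat \<Rightarrow> nat \<Rightarrow> real" where
  "bca_lambda_tilde T m n p \<gamma> c \<epsilon> X Y r t j = \<epsilon> * ln (snd (bca_iterate T m n p \<gamma> c \<epsilon> X Y r) t j)"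

end

theory Submission
  imports Defs
begin

text \<open>The transition cost is infinite as soon as the row index changes, so a path has positive weight
exactly when its row index is constant.  The exponent of that weight contains one row multiplier
and one column multiplier per time step, and up to the factor \<open>- \<epsilon>\<close> and an additive constant the
dual objective is

  \<open>F x = (\<Sum>s. q s * (exp (z s) - z s))\<close>,  \<open>z s = a s + (\<Sum>b. x b (\<sigma> b s))\<close>,

where \<open>b\<close> runs over the \<open>2 T\<close> blocks of multipliers divided by \<open>\<epsilon>\<close>, \<open>\<sigma> b s\<close> is the coordinate of
block \<open>b\<close> that the path \<open>s\<close> uses, and \<open>q\<close> is any strictly positive tensor with the prescribed
marginals.  Here the product of the marginals, restricted to paths of constant row, serves as
\<open>q\<close> (\<open>coupling_pair_marginal\<close>).  Strict positivity of \<open>q\<close> makes \<open>F\<close> coercive in the exponents \<open>z\<close>.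

Each update of the algorithm minimises \<open>F\<close> exactly in one block.  On a level set of \<open>F\<close> all
exponents are bounded, and linear convergence follows from three estimates there:
the decrease of \<open>F\<close> in an update dominates the squared length of the step
(\<open>step_squared_le_decrease\<close>); the violation of the marginal constraints, which is the gradient of
\<open>F\<close>, is at most a multiple of the length of the path that one pass travels, because each block is
feasible directly after its own update (\<open>residual_le_path_length\<close>); and the gap of \<open>F\<close> to its
infimum is at most a multiple of the squared gradient (\<open>gradient_domination\<close>).  The last estimate is
the strong convexity of \<open>F\<close> as a function of the exponents.  The multipliers themselves are not
determined by the exponents, and \<open>F\<close> is constant along the undetermined directions; the estimate
survives because a change of the exponents can always be realised by a change of the multipliers of
comparable size (\<open>gauge_fixing\<close>).

Together the estimates bound the gap before a pass by a multiple of the decrease during the pass,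
so the gap decays geometrically.  The steps are bounded by the square root of the gap, hence are
geometrically summable: the multipliers converge, not merely the exponents, and the limit attains
the infimum.  In particular existence of a dual optimum need not be established beforehand.

That the algorithm really performs these block updates is the correctness of message passing on a
chain (\<open>chain_marginal\<close>): the product of forward message, local kernel and backward message is the
marginal of the path weights.  Within a pass, at time \<open>t\<close>, the forward message has seen all
multipliers before \<open>t\<close> in their updated form, and the multipliers after \<open>t\<close> that enter the backward
message have not been changed yet, so both messages are those of the current multipliers
(\<open>time_step_rescales\<close>).\<close>

section \<open>Estimates for the exponential function and geometric steps\<close>

text \<open>This is the source of strong convexity: the second derivative of the exponential is at least
\<open>exp (- R)\<close> on \<open>[- R, R]\<close>.\<close>
lemma exp_quadratic_lower:
  fixes v :: real
  assumes "\<bar>v\<bar> \<le> R"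
  shows "1 + v + exp (- R) / 2 * v\<^sup>2 \<le> exp v"
proof -
  obtain t where t: "\<bar>t\<bar> \<le> \<bar>v\<bar>" "exp v = (\<Sum>m<2. v ^ m / fact m) + exp t / fact 2 * v ^ 2"
    using Maclaurin_exp_le[of v 2] by blast
  have "exp (- R) \<le> exp t" using t(1) assms by simp
  then have "exp (- R) / 2 * v\<^sup>2 \<le> exp t / 2 * v\<^sup>2"
    by (intro mult_right_mono) auto
  then show ?thesis using t(2) by (simp add: eval_nat_numeral)
qed

text \<open>Coercivity of \<open>exp v - v\<close> in both directions, with a linear lower bound that is enough to bound the
exponents on level sets.\<close>
lemma abs_le_exp_minus_self: "\<bar>v\<bar> \<le> exp v - v" for v :: real
proof (cases "v \<ge> 0")
  case True
  have "1 + v + v\<^sup>2 / 2 \<le> exp v" using exp_lower_Taylor_quadratic[OF True] .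
  moreover have "v \<le> 1 + v\<^sup>2 / 2" using zero_le_power2[of "v - 1"] by (simp add: power2_eq_square algebra_simps)
  ultimately show ?thesis using True by linarith
qed auto

lemma self_le_exp: "v \<le> exp v" for v :: real
  using exp_ge_add_one_self[of v] by linarith

lemma exp_diff_le:
  fixes v w :: real
  assumes "\<bar>v\<bar> \<le> R" "\<bar>w\<bar> \<le> R"
  shows "\<bar>exp v - exp w\<bar> \<le> exp R * \<bar>v - w\<bar>"
proof -
  have *: "exp v - exp w \<le> exp R * \<bar>v - w\<bar>" if "\<bar>v\<bar> \<le> R" for v w :: real
  proof -
    have "1 + (w - v) \<le> exp (w - v)" by (rule exp_ge_add_one_self)
    then have "exp v * (1 + (w - v)) \<le> exp v * exp (w - v)" by (intro mult_left_mono) auto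
    also have "\<dots> = exp w" by (simp add: exp_diff)
    finally have "exp v - exp w \<le> exp v * (v - w)" by (simp add: algebra_simps)
    also have "\<dots> \<le> exp v * \<bar>v - w\<bar>" by (intro mult_left_mono) auto
    also have "\<dots> \<le> exp R * \<bar>v - w\<bar>" using that by (intro mult_right_mono) auto
    finally show ?thesis .
  qed
  show ?thesis using *[OF assms(1), of w] *[OF assms(2), of v] by (simp add: abs_minus_commute)
qed

lemma geometric_steps_limit:
  fixes a :: "nat \<Rightarrow> real"
  assumes "0 \<le> \<rho>" "\<rho> < 1" and step: "\<And>r. \<bar>a (Suc r) - a r\<bar> \<le> K * \<rho> ^ r"
  shows "\<exists>l. \<forall>r. \<bar>a r - l\<bar> \<le> K / (1 - \<rho>) * \<rho> ^ r"
proof -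
  define d where "d r = a (Suc r) - a r" for r
  have geo: "(\<lambda>i. K * \<rho> ^ (i + r)) sums (K / (1 - \<rho>) * \<rho> ^ r)" for r
    using sums_mult[OF geometric_sums, of \<rho> "K * \<rho> ^ r"] assms by (simp add: power_add mult_ac)
  have sm: "summable (\<lambda>i. d (i + r))" for r
    using step by (intro summable_comparison_test'[OF sums_summable[OF geo[of r]], of 0]) (auto simp: d_def)
  have tl: "(\<lambda>i. d (i + r)) sums (a 0 + suminf d - a r)" for r
  proof -
    have "(\<Sum>i<r. d i) = a r - a 0" by (simp add: d_def sum_lessThan_telescope)
    then have e: "suminf d - (\<Sum>i<r. d i) = a 0 + suminf d - a r" by simp
    have "(\<lambda>i. d (i + r)) sums (suminf d - (\<Sum>i<r. d i))"
      using sm[of 0] by (intro sums_split_initial_segment summable_sums) simp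
    then show ?thesis by (simp only: e)
  qed
  have "\<bar>a r - (a 0 + suminf d)\<bar> \<le> K / (1 - \<rho>) * \<rho> ^ r" for r
  proof -
    have "norm (suminf (\<lambda>i. d (i + r))) \<le> suminf (\<lambda>i. K * \<rho> ^ (i + r))"
      using step by (intro norm_suminf_le sums_summable[OF geo]) (auto simp: d_def)
    then show ?thesis using sums_unique[OF tl[of r]] sums_unique[OF geo[of r]] by simp
  qed
  then show ?thesis by blast
qed

section \<open>Exact block minimisation of an exponential sum\<close>

text \<open>A path \<open>s\<close> uses the coordinate \<open>\<sigma> k s\<close> of block \<open>k\<close>.  The coordinates of block \<open>k\<close> are the elements of
\<open>\<sigma> k ` S\<close>, so each of them is used by some path.  The assumption \<open>gauge\<close> is a bounded right inverse:
whatever a displacement \<open>\<delta>\<close> does to the exponents can also be done by a displacement whose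
size is controlled by the change of the exponents alone.  It makes up for the redundancy of the
multipliers, since \<open>\<delta>\<close> itself may be large while the exponents do not move at all.\<close>
locale block_scaling =
  fixes S :: "'s set" and q a :: "'s \<Rightarrow> real" and ks :: "'k list"
    and \<sigma> :: "'k \<Rightarrow> 's \<Rightarrow> 'i" and C :: real
  assumes finite_S: "finite S"
    and q_pos: "s \<in> S \<Longrightarrow> 0 < q s"
    and gauge: "\<exists>\<delta>'. (\<forall>s\<in>S. (\<Sum>k\<in>set ks. \<delta>' k (\<sigma> k s)) = (\<Sum>k\<in>set ks. \<delta> k (\<sigma> k s))) \<and>
        (\<forall>k\<in>set ks. \<forall>i\<in>\<sigma> k ` S. \<bar>\<delta>' k i\<bar> \<le> C * (\<Sum>s\<in>S. \<bar>\<Sum>k\<in>set ks. \<delta> k (\<sigma> k s)\<bar>))"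
begin

definition expo :: "('k \<Rightarrow> 'i \<Rightarrow> real) \<Rightarrow> 's \<Rightarrow> real" where
  "expo x s = a s + (\<Sum>k\<in>set ks. x k (\<sigma> k s))"

text \<open>With \<open>q\<close> having the target marginals, the linear term of the dual objective becomes a sum over
paths, and the objective splits into one convex function of one exponent per path.\<close>
definition potential :: "('k \<Rightarrow> 'i \<Rightarrow> real) \<Rightarrow> real" where
  "potential x = (\<Sum>s\<in>S. q s * (exp (expo x s) - expo x s))"

definition fibre :: "'k \<Rightarrow> 'i \<Rightarrow> 's set" where
  "fibre k i = {s \<in> S. \<sigma> k s = i}"

definition target :: "'k \<Rightarrow> 'i \<Rightarrow> real" where
  "target k i = (\<Sum>s\<in>fibre k i. q s)"

definition marginal :: "('k \<Rightarrow> 'i \<Rightarrow> real) \<Rightarrow> 'k \<Rightarrow> 'i \<Rightarrow> real" where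
  "marginal x k i = (\<Sum>s\<in>fibre k i. q s * exp (expo x s))"

text \<open>The logarithm of the factor by which a coordinate is scaled so that its marginal becomes the
target.\<close>
definition incr :: "('k \<Rightarrow> 'i \<Rightarrow> real) \<Rightarrow> 'k \<Rightarrow> 'i \<Rightarrow> real" where
  "incr x k i = ln (target k i / marginal x k i)"

definition rescale :: "'k \<Rightarrow> ('k \<Rightarrow> 'i \<Rightarrow> real) \<Rightarrow> 'k \<Rightarrow> 'i \<Rightarrow> real" where
  "rescale k x = x(k := (\<lambda>i. x k i + incr x k i))"

definition step_size :: "'k \<Rightarrow> ('k \<Rightarrow> 'i \<Rightarrow> real) \<Rightarrow> real" where
  "step_size k x = (\<Sum>i\<in>\<sigma> k ` S. \<bar>incr x k i\<bar>)"

primrec path_length :: "'k list \<Rightarrow> ('k \<Rightarrow> 'i \<Rightarrow> real) \<Rightarrow> real" where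
  "path_length [] x = 0"
| "path_length (k # l) x = step_size k x + path_length l (rescale k x)"

text \<open>The gradient of the potential at coordinate \<open>i\<close> of block \<open>k\<close> is marginal minus target; the residual
is its norm as a sum of absolute values.\<close>
definition residual :: "('k \<Rightarrow> 'i \<Rightarrow> real) \<Rightarrow> real" where
  "residual x = (\<Sum>k\<in>set ks. \<Sum>i\<in>\<sigma> k ` S. \<bar>marginal x k i - target k i\<bar>)"

lemma finite_fibre [simp]: "finite (fibre k i)"
  using finite_S by (simp add: fibre_def)

lemma sum_over_fibre:
  fixes h :: "'s \<Rightarrow> real"
  shows "(\<Sum>s\<in>fibre k i. h s) = (\<Sum>s\<in>S. h s * of_bool (\<sigma> k s = i))"
  unfolding fibre_def sum.inter_filter[OF finite_S] by (intro sum.cong) auto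

lemma sum_by_fibres: "(\<Sum>s\<in>S. h s) = (\<Sum>i\<in>\<sigma> k ` S. \<Sum>s\<in>fibre k i. h s)"
  unfolding fibre_def using finite_S by (rule sum.image_gen)

text \<open>Summation by parts: a displacement of the multipliers paired with path weights equals the same
displacement paired with the marginals of these weights.\<close>
lemma sum_pairing:
  fixes h :: "'s \<Rightarrow> real"
  shows "(\<Sum>s\<in>S. h s * (\<Sum>k\<in>set ks. \<delta> k (\<sigma> k s)))
      = (\<Sum>k\<in>set ks. \<Sum>i\<in>\<sigma> k ` S. \<delta> k i * (\<Sum>s\<in>fibre k i. h s))"
proof -
  have "(\<Sum>s\<in>S. h s * (\<Sum>k\<in>set ks. \<delta> k (\<sigma> k s))) = (\<Sum>k\<in>set ks. \<Sum>s\<in>S. h s * \<delta> k (\<sigma> k s))"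
    by (subst sum.swap) (simp add: sum_distrib_left)
  also have "\<dots> = (\<Sum>k\<in>set ks. \<Sum>i\<in>\<sigma> k ` S. \<delta> k i * (\<Sum>s\<in>fibre k i. h s))"
    by (intro sum.cong refl, subst sum_by_fibres, intro sum.cong refl)
      (auto simp: sum_distrib_left fibre_def mult.commute intro!: sum.cong)
  finally show ?thesis .
qed

lemma target_pos: "i \<in> \<sigma> k ` S \<Longrightarrow> 0 < target k i"
  unfolding target_def by (rule sum_pos) (auto simp: q_pos, auto simp: fibre_def q_pos)

lemma marginal_pos: "i \<in> \<sigma> k ` S \<Longrightarrow> 0 < marginal x k i"
  unfolding marginal_def by (rule sum_pos) (auto simp: q_pos, auto simp: fibre_def q_pos)

lemma marginal_eq: "i \<in> \<sigma> k ` S \<Longrightarrow> marginal x k i = target k i * exp (- incr x k i)"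
  using target_pos[of i k] marginal_pos[of i k x] by (simp add: incr_def exp_minus)

lemma expo_rescale:
  assumes "k \<in> set ks"
  shows "expo (rescale k x) s = expo x s + incr x k (\<sigma> k s)"
  unfolding expo_def rescale_def using assms
  by (simp add: sum.remove[of "set ks" k])

lemma marginal_rescale:
  assumes "k \<in> set ks" "i \<in> \<sigma> k ` S"
  shows "marginal (rescale k x) k i = target k i"
proof -
  have "marginal (rescale k x) k i = marginal x k i * exp (incr x k i)"
    unfolding marginal_def sum_distrib_right
    by (intro sum.cong) (auto simp: expo_rescale[OF assms(1)] exp_add fibre_def)
  then show ?thesis using marginal_eq[OF assms(2), of x] by (simp add: exp_minus)
qed

text \<open>The decrease is a Bregman divergence between the old and the new marginal.  It is nonnegative
without any bound on \<open>x\<close>, and quadratic in the increment where the exponents are bounded.\<close>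
lemma potential_rescale:
  assumes "k \<in> set ks"
  shows "potential x - potential (rescale k x)
    = (\<Sum>i\<in>\<sigma> k ` S. target k i * (exp (- incr x k i) - 1 + incr x k i))"
proof -
  have "potential x - potential (rescale k x)
     = (\<Sum>s\<in>S. q s * exp (expo x s) - q s * exp (expo (rescale k x) s) + q s * incr x k (\<sigma> k s))"
    unfolding potential_def sum_subtractf[symmetric]
    by (intro sum.cong) (auto simp: expo_rescale[OF assms] algebra_simps)
  also have "\<dots> = (\<Sum>i\<in>\<sigma> k ` S. marginal x k i - marginal (rescale k x) k i + target k i * incr x k i)"
    unfolding sum_by_fibres[of _ k] marginal_def target_def
    by (intro sum.cong) (auto simp: sum.distrib sum_subtractf sum_distrib_right fibre_def)
  also have "\<dots> = (\<Sum>i\<in>\<sigma> k ` S. target k i * (exp (- incr x k i) - 1 + incr x k i))"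
    using assms by (intro sum.cong) (auto simp: marginal_rescale marginal_eq[of _ _ x] algebra_simps)
  finally show ?thesis .
qed

lemma potential_rescale_le:
  assumes "k \<in> set ks"
  shows "potential (rescale k x) \<le> potential x"
proof -
  have "0 \<le> exp (- incr x k i) - 1 + incr x k i" for i
    using exp_ge_add_one_self[of "- incr x k i"] by linarith
  then have "0 \<le> potential x - potential (rescale k x)"
    unfolding potential_rescale[OF assms] using target_pos by (intro sum_nonneg mult_nonneg_nonneg) (auto simp: less_imp_le)
  then show ?thesis by simp
qed

lemma potential_fold_le: "set l \<subseteq> set ks \<Longrightarrow> potential (fold rescale l x) \<le> potential x"
  by (induction l arbitrary: x) (auto intro: order_trans[OF _ potential_rescale_le])

lemma abs_expo_le_potential: "s \<in> S \<Longrightarrow> q s * \<bar>expo x s\<bar> \<le> potential x"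
proof -
  assume s: "s \<in> S"
  have ge: "q s * \<bar>expo x s\<bar> \<le> q s * (exp (expo x s) - expo x s)" if "s \<in> S" for s
    using q_pos[OF that] abs_le_exp_minus_self by (intro mult_left_mono) auto
  have "q s * (exp (expo x s) - expo x s) \<le> potential x"
    unfolding potential_def using finite_S s
    by (intro member_le_sum) (auto intro!: mult_nonneg_nonneg simp: less_imp_le[OF q_pos] self_le_exp)
  then show ?thesis using ge[OF s] by linarith
qed

lemma potential_nonneg: "0 \<le> potential x"
  unfolding potential_def
  by (intro sum_nonneg mult_nonneg_nonneg)
    (auto simp: less_imp_le[OF q_pos] self_le_exp)

lemma level_bound: "\<exists>R\<ge>0. \<forall>x. potential x \<le> c \<longrightarrow> (\<forall>s\<in>S. \<bar>expo x s\<bar> \<le> R)"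
proof (intro exI conjI allI impI ballI)
  show "0 \<le> (\<Sum>s\<in>S. \<bar>c\<bar> / q s)" by (intro sum_nonneg) (auto simp: less_imp_le[OF q_pos])
  fix x s assume "potential x \<le> c" "s \<in> S"
  then have "\<bar>expo x s\<bar> \<le> \<bar>c\<bar> / q s"
    using abs_expo_le_potential[of s x] q_pos[of s] by (simp add: field_simps)
  also have "\<dots> \<le> (\<Sum>s\<in>S. \<bar>c\<bar> / q s)"
    using finite_S \<open>s \<in> S\<close> by (intro member_le_sum) (auto simp: less_imp_le[OF q_pos])
  finally show "\<bar>expo x s\<bar> \<le> (\<Sum>s\<in>S. \<bar>c\<bar> / q s)" .
qed

lemma q_lower: "\<exists>q0>0. \<forall>s\<in>S. q0 \<le> q s"
proof (cases "S = {}")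
  case False
  then show ?thesis using finite_S q_pos
    by (intro exI[of _ "Min (q ` S)"]) (auto simp: Min_gr_iff)
qed (auto intro: exI[of _ 1])

text \<open>The marginal and the target of a coordinate are sums over the same paths, and corresponding terms have
quotient \<open>exp (expo x s)\<close>, so the quotient of the sums lies between the extreme values of these.\<close>
lemma abs_incr_le:
  assumes b: "\<forall>s\<in>S. \<bar>expo x s\<bar> \<le> R" and i: "i \<in> \<sigma> k ` S"
  shows "\<bar>incr x k i\<bar> \<le> R"
proof -
  have "target k i * exp (- R) \<le> marginal x k i"
    unfolding target_def marginal_def sum_distrib_right
  proof (intro sum_mono mult_left_mono)
    fix s assume "s \<in> fibre k i"
    then have "s \<in> S" by (simp add: fibre_def)
    then show "exp (- R) \<le> exp (expo x s)" "0 \<le> q s" using b q_pos[of s] by (auto simp: abs_le_iff)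
  qed
  moreover have "marginal x k i \<le> target k i * exp R"
    unfolding target_def marginal_def sum_distrib_right
  proof (intro sum_mono mult_left_mono)
    fix s assume "s \<in> fibre k i"
    then have "s \<in> S" by (simp add: fibre_def)
    then show "exp (expo x s) \<le> exp R" "0 \<le> q s" using b q_pos[of s] by (auto simp: abs_le_iff)
  qed
  ultimately have "exp (- R) \<le> exp (- incr x k i)" "exp (- incr x k i) \<le> exp R"
    using target_pos[OF i] unfolding marginal_eq[OF i] by simp_all
  then show ?thesis by (simp add: abs_le_iff)
qed

lemma sum_abs_squared_le:
  fixes f :: "'b \<Rightarrow> real"
  shows "(\<Sum>i\<in>A. \<bar>f i\<bar>)\<^sup>2 \<le> real (card A) * (\<Sum>i\<in>A. (f i)\<^sup>2)"
  using sum_squared_le_sum_of_squares[of "\<lambda>i. \<bar>f i\<bar>" A] by (simp add: mult.commute)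

text \<open>On a level set the increments are bounded, and there the Bregman divergence that a step gains is
quadratic in the increments.\<close>
lemma step_squared_le_decrease:
  "\<exists>B\<ge>0. \<forall>x k. potential x \<le> c \<longrightarrow> k \<in> set ks \<longrightarrow>
     (step_size k x)\<^sup>2 \<le> B * (potential x - potential (rescale k x))"
proof -
  obtain R where R: "R \<ge> 0" "\<And>x s. potential x \<le> c \<Longrightarrow> s \<in> S \<Longrightarrow> \<bar>expo x s\<bar> \<le> R"
    using level_bound[of c] by blast
  obtain q0 where q0: "q0 > 0" "\<And>s. s \<in> S \<Longrightarrow> q0 \<le> q s" using q_lower by blast
  define h where "h = q0 * (exp (- R) / 2)"
  have h: "h > 0" using q0 by (simp add: h_def)
  have "(step_size k x)\<^sup>2 \<le> (real (card S) / h) * (potential x - potential (rescale k x))"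
    if x: "potential x \<le> c" and k: "k \<in> set ks" for x k
  proof -
    have "h * (\<Sum>i\<in>\<sigma> k ` S. (incr x k i)\<^sup>2) \<le> potential x - potential (rescale k x)"
      unfolding potential_rescale[OF k] sum_distrib_left
    proof (rule sum_mono)
      fix i assume i: "i \<in> \<sigma> k ` S"
      have "\<bar>- incr x k i\<bar> \<le> R" using abs_incr_le[OF _ i] R(2)[OF x] by simp
      from exp_quadratic_lower[OF this]
      have e: "exp (- R) / 2 * (incr x k i)\<^sup>2 \<le> exp (- incr x k i) - 1 + incr x k i" by simp
      obtain s where s: "s \<in> fibre k i" "s \<in> S" using i by (auto simp: fibre_def)
      have "q s \<le> target k i" unfolding target_def
        by (rule member_le_sum[OF s(1)]) (auto simp: fibre_def less_imp_le[OF q_pos], use finite_fibre in \<open>simp add: fibre_def\<close>)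
      then have "q0 \<le> target k i" using q0(2)[OF s(2)] by simp
      then have "q0 * (exp (- R) / 2 * (incr x k i)\<^sup>2) \<le> target k i * (exp (- incr x k i) - 1 + incr x k i)"
        using e q0(1) by (intro mult_mono) auto
      then show "h * (incr x k i)\<^sup>2 \<le> target k i * (exp (- incr x k i) - 1 + incr x k i)"
        by (simp add: h_def mult.assoc)
    qed
    then have "(\<Sum>i\<in>\<sigma> k ` S. (incr x k i)\<^sup>2) \<le> (potential x - potential (rescale k x)) / h"
      using h by (simp add: field_simps)
    then have "real (card (\<sigma> k ` S)) * (\<Sum>i\<in>\<sigma> k ` S. (incr x k i)\<^sup>2)
        \<le> real (card S) * ((potential x - potential (rescale k x)) / h)"
      using card_image_le[OF finite_S, of "\<sigma> k"] by (intro mult_mono sum_nonneg) auto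
    then show ?thesis unfolding step_size_def
      using sum_abs_squared_le[of "incr x k" "\<sigma> k ` S"] by simp
  qed
  then show ?thesis using h by (intro exI[of _ "real (card S) / h"]) auto
qed

lemma step_size_nonneg: "0 \<le> step_size k x"
  by (simp add: step_size_def sum_nonneg)

lemma path_length_nonneg: "0 \<le> path_length l x"
  by (induction l arbitrary: x) (auto simp: step_size_nonneg)

lemma path_length_append:
  "path_length (l @ l') x = path_length l x + path_length l' (fold rescale l x)"
  by (induction l arbitrary: x) auto

lemma abs_incr_le_step_size: "i \<in> \<sigma> k ` S \<Longrightarrow> \<bar>incr x k i\<bar> \<le> step_size k x"
  unfolding step_size_def using finite_S by (intro member_le_sum) auto

lemma expo_moves_le:
  "set l \<subseteq> set ks \<Longrightarrow> s \<in> S \<Longrightarrow> \<bar>expo (fold rescale l x) s - expo x s\<bar> \<le> path_length l x"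
proof (induction l arbitrary: x)
  case (Cons k l)
  have "\<bar>expo (rescale k x) s - expo x s\<bar> \<le> step_size k x"
    using Cons.prems abs_incr_le_step_size[of "\<sigma> k s" k x] by (simp add: expo_rescale)
  moreover have "\<bar>expo (fold rescale l (rescale k x)) s - expo (rescale k x) s\<bar> \<le> path_length l (rescale k x)"
    using Cons by simp
  ultimately show ?case by simp
qed simp

lemma coordinate_moves_le:
  "i \<in> \<sigma> k ` S \<Longrightarrow> \<bar>fold rescale l x k i - x k i\<bar> \<le> path_length l x"
proof (induction l arbitrary: x)
  case (Cons k' l)
  have "\<bar>rescale k' x k i - x k i\<bar> \<le> step_size k' x"
    using Cons.prems abs_incr_le_step_size[of i k x] step_size_nonneg[of k' x]
    by (cases "k = k'") (simp_all add: rescale_def)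
  moreover have "\<bar>fold rescale l (rescale k' x) k i - rescale k' x k i\<bar> \<le> path_length l (rescale k' x)"
    using Cons by simp
  ultimately show ?case by simp
qed simp

text \<open>Every update in a pass decreases the potential by at most the total decrease of the pass, so each of
the steps is bounded by the square root of that total.\<close>
lemma path_length_le_decrease:
  assumes B: "B \<ge> 0" "\<And>x k. potential x \<le> c \<Longrightarrow> k \<in> set ks \<Longrightarrow>
     (step_size k x)\<^sup>2 \<le> B * (potential x - potential (rescale k x))"
  shows "set l \<subseteq> set ks \<Longrightarrow> potential x \<le> c \<Longrightarrow>
    path_length l x \<le> real (length l) * sqrt (B * (potential x - potential (fold rescale l x)))"
proof (induction l arbitrary: x)
  case (Cons k l)
  let ?y = "rescale k x" and ?e = "fold rescale l (rescale k x)"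
  have y: "potential ?y \<le> potential x" "potential ?e \<le> potential ?y"
    using Cons.prems potential_rescale_le potential_fold_le by auto
  have "step_size k x \<le> sqrt (B * (potential x - potential ?y))"
    using B(2)[of x k] Cons.prems by (intro real_le_rsqrt) auto
  also have "\<dots> \<le> sqrt (B * (potential x - potential ?e))"
    using y B(1) by (intro real_sqrt_le_mono mult_left_mono) auto
  finally have 1: "step_size k x \<le> sqrt (B * (potential x - potential ?e))" .
  have "path_length l ?y \<le> real (length l) * sqrt (B * (potential ?y - potential ?e))"
    using Cons y by auto
  also have "\<dots> \<le> real (length l) * sqrt (B * (potential x - potential ?e))"
    using y B(1) by (intro mult_left_mono real_sqrt_le_mono) auto
  finally show ?case using 1 by (simp add: algebra_simps)
qed simp

text \<open>Directly after its update a block has the target marginal.  Its residual at the start of the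
pass is thus the change of its marginal between two points of the pass, and the marginal is Lipschitz
in the exponents on a level set.\<close>
lemma residual_le_path_length:
  "\<exists>L\<ge>0. \<forall>x. potential x \<le> c \<longrightarrow> residual x \<le> L * path_length ks x"
proof -
  obtain R where R: "R \<ge> 0" "\<And>x s. potential x \<le> c \<Longrightarrow> s \<in> S \<Longrightarrow> \<bar>expo x s\<bar> \<le> R"
    using level_bound[of c] by blast
  define L where "L = (\<Sum>s\<in>S. q s * exp R)"
  have L: "L \<ge> 0" unfolding L_def by (intro sum_nonneg) (auto simp: less_imp_le[OF q_pos])
  have blk: "(\<Sum>i\<in>\<sigma> k ` S. \<bar>marginal x k i - target k i\<bar>) \<le> L * path_length ks x"
    if x: "potential x \<le> c" and k: "k \<in> set ks" for x k
  proof -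
    \<comment> \<open>The prefix of the pass that ends with an update of block \<open>k\<close>.\<close>
    obtain l l' where l: "ks = (l @ [k]) @ l'" using split_list[OF k] by auto
    let ?y = "fold rescale (l @ [k]) x"
    have sub: "set (l @ [k]) \<subseteq> set ks" using l by (metis Un_upper1 set_append)
    have y: "potential ?y \<le> c" using potential_fold_le[OF sub, of x] x by linarith
    have pl: "path_length (l @ [k]) x \<le> path_length ks x"
      by (subst l, subst path_length_append) (use path_length_nonneg in simp)
    have df: "\<bar>exp (expo x s) - exp (expo ?y s)\<bar> \<le> exp R * path_length ks x" if "s \<in> S" for s
    proof -
      have "\<bar>exp (expo x s) - exp (expo ?y s)\<bar> \<le> exp R * \<bar>expo x s - expo ?y s\<bar>"
        using R(2)[OF x that] R(2)[OF y that] by (rule exp_diff_le)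
      also have "\<dots> \<le> exp R * path_length ks x"
        using expo_moves_le[OF sub that, of x] pl by (intro mult_left_mono) (auto simp: abs_minus_commute)
      finally show ?thesis .
    qed
    have "(\<Sum>i\<in>\<sigma> k ` S. \<bar>marginal x k i - target k i\<bar>)
        = (\<Sum>i\<in>\<sigma> k ` S. \<bar>marginal x k i - marginal ?y k i\<bar>)"
      using k by (intro sum.cong) (simp_all add: marginal_rescale)
    also have "\<dots> = (\<Sum>i\<in>\<sigma> k ` S. \<bar>\<Sum>s\<in>fibre k i. q s * (exp (expo x s) - exp (expo ?y s))\<bar>)"
      by (simp only: marginal_def sum_subtractf[symmetric] right_diff_distrib)
    also have "\<dots> \<le> (\<Sum>i\<in>\<sigma> k ` S. \<Sum>s\<in>fibre k i. \<bar>q s * (exp (expo x s) - exp (expo ?y s))\<bar>)"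
      by (intro sum_mono sum_abs)
    also have "\<dots> = (\<Sum>s\<in>S. \<bar>q s * (exp (expo x s) - exp (expo ?y s))\<bar>)"
      by (rule sum_by_fibres[symmetric])
    also have "\<dots> \<le> (\<Sum>s\<in>S. q s * (exp R * path_length ks x))"
      unfolding abs_mult using df by (intro sum_mono mult_mono) (auto simp: abs_of_pos[OF q_pos] less_imp_le[OF q_pos])
    also have "\<dots> = L * path_length ks x"
      by (simp add: L_def sum_distrib_right mult.assoc)
    finally show ?thesis .
  qed
  have "residual x \<le> (real (card (set ks)) * L) * path_length ks x" if "potential x \<le> c" for x
    using sum_bounded_above[of "set ks" "\<lambda>k. \<Sum>i\<in>\<sigma> k ` S. \<bar>marginal x k i - target k i\<bar>", OF blk[OF that]]
    by (simp add: residual_def mult.assoc)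
  then show ?thesis using L by (intro exI[of _ "real (card (set ks)) * L"]) auto
qed

text \<open>A Polyak-Lojasiewicz inequality.  By strong convexity in the exponents, going from \<open>x\<close> to \<open>x'\<close>
raises the potential by at least the linear term plus \<open>h * N\<^sup>2\<close>, where \<open>N\<close> measures the change of the
exponents.  By \<open>gauge\<close> the linear term is at least \<open>- C * N * residual x\<close>, and minimising over \<open>N\<close>
leaves a multiple of the squared residual.  As \<open>x'\<close> is arbitrary on the level set, no minimiser
is involved.\<close>
lemma gradient_domination:
  "\<exists>K\<ge>0. \<forall>x x'. potential x \<le> c \<longrightarrow> potential x' \<le> c \<longrightarrow> potential x - potential x' \<le> K * (residual x)\<^sup>2"
proof -
  obtain R where R: "R \<ge> 0" "\<And>x s. potential x \<le> c \<Longrightarrow> s \<in> S \<Longrightarrow> \<bar>expo x s\<bar> \<le> R"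
    using level_bound[of c] by blast
  obtain q0 where q0: "q0 > 0" "\<And>s. s \<in> S \<Longrightarrow> q0 \<le> q s" using q_lower by blast
  \<comment> \<open>One factor \<open>exp (- R)\<close> bounds \<open>exp (expo x s)\<close> from below, the other comes from convexity on \<open>[- 2 R, 2 R]\<close>, where differences of exponents lie; the division by \<open>card S + 1\<close> prepares for Cauchy-Schwarz.\<close>
  define h where "h = q0 * exp (- R) * exp (- 2 * R) / 2 / (real (card S) + 1)"
  have h: "h > 0" using q0 by (simp add: h_def)
  have "potential x - potential x' \<le> C\<^sup>2 / (4 * h) * (residual x)\<^sup>2"
    if x: "potential x \<le> c" and x': "potential x' \<le> c" for x x'
  proof -
    define \<delta> where "\<delta> k i = x' k i - x k i" for k i
    define \<eta> where "\<eta> s = (\<Sum>k\<in>set ks. \<delta> k (\<sigma> k s))" for s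
    define N where "N = (\<Sum>s\<in>S. \<bar>\<eta> s\<bar>)"
    have \<eta>: "expo x' s = expo x s + \<eta> s" for s
      by (simp add: expo_def \<eta>_def \<delta>_def sum_subtractf)
    obtain \<delta>' where d1: "\<And>s. s \<in> S \<Longrightarrow> (\<Sum>k\<in>set ks. \<delta>' k (\<sigma> k s)) = \<eta> s"
      and d2: "\<And>k i. k \<in> set ks \<Longrightarrow> i \<in> \<sigma> k ` S \<Longrightarrow> \<bar>\<delta>' k i\<bar> \<le> C * N"
      using gauge[of \<delta>] unfolding \<eta>_def N_def by blast
    have quad: "q s * (exp (expo x s) - 1) * \<eta> s + h * (real (card S) + 1) * (\<eta> s)\<^sup>2
        \<le> q s * (exp (expo x' s) - expo x' s) - q s * (exp (expo x s) - expo x s)" if s: "s \<in> S" for s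
    proof -
      have b: "\<bar>expo x s\<bar> \<le> R" "\<bar>expo x' s\<bar> \<le> R" using R(2) x x' s by auto
      then have "\<bar>\<eta> s\<bar> \<le> 2 * R" using \<eta>[of s] by linarith
      from exp_quadratic_lower[OF this]
      have "exp (expo x s) * (1 + \<eta> s + exp (- 2 * R) / 2 * (\<eta> s)\<^sup>2) \<le> exp (expo x s) * exp (\<eta> s)"
        by (intro mult_left_mono) auto
      then have e: "exp (expo x s) * \<eta> s + exp (expo x s) * (exp (- 2 * R) / 2 * (\<eta> s)\<^sup>2)
          \<le> exp (expo x' s) - exp (expo x s)"
        by (simp add: \<eta> exp_add algebra_simps)
      have "exp (- R) * (exp (- 2 * R) / 2 * (\<eta> s)\<^sup>2) \<le> exp (expo x s) * (exp (- 2 * R) / 2 * (\<eta> s)\<^sup>2)"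
        using b by (intro mult_right_mono) auto
      then have "(exp (expo x s) - 1) * \<eta> s + exp (- R) * (exp (- 2 * R) / 2 * (\<eta> s)\<^sup>2)
          \<le> (exp (expo x' s) - expo x' s) - (exp (expo x s) - expo x s)"
        using e \<eta>[of s] unfolding left_diff_distrib mult_1 by linarith
      then have "q s * ((exp (expo x s) - 1) * \<eta> s + exp (- R) * (exp (- 2 * R) / 2 * (\<eta> s)\<^sup>2))
          \<le> q s * ((exp (expo x' s) - expo x' s) - (exp (expo x s) - expo x s))"
        using q_pos[OF s] by (intro mult_left_mono) auto
      moreover have "h * (real (card S) + 1) * (\<eta> s)\<^sup>2 = q0 * (exp (- R) * (exp (- 2 * R) / 2 * (\<eta> s)\<^sup>2))"
        by (simp add: h_def field_simps)
      moreover have "q0 * (exp (- R) * (exp (- 2 * R) / 2 * (\<eta> s)\<^sup>2)) \<le> q s * (exp (- R) * (exp (- 2 * R) / 2 * (\<eta> s)\<^sup>2))"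
        using q0(2)[OF s] by (intro mult_right_mono) auto
      ultimately show ?thesis unfolding mult.assoc unfolding distrib_left right_diff_distrib by linarith
    qed
    have lin: "\<bar>\<Sum>s\<in>S. q s * (exp (expo x s) - 1) * \<eta> s\<bar> \<le> C * N * residual x"
    proof -
      have "(\<Sum>s\<in>S. q s * (exp (expo x s) - 1) * \<eta> s)
          = (\<Sum>s\<in>S. q s * (exp (expo x s) - 1) * (\<Sum>k\<in>set ks. \<delta>' k (\<sigma> k s)))"
        by (simp add: d1)
      also have "\<dots> = (\<Sum>k\<in>set ks. \<Sum>i\<in>\<sigma> k ` S. \<delta>' k i * (\<Sum>s\<in>fibre k i. q s * (exp (expo x s) - 1)))"
        by (rule sum_pairing)
      also have "\<dots> = (\<Sum>k\<in>set ks. \<Sum>i\<in>\<sigma> k ` S. \<delta>' k i * (marginal x k i - target k i))"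
        by (simp add: marginal_def target_def right_diff_distrib sum_subtractf)
      also have "\<bar>\<dots>\<bar> \<le> (\<Sum>k\<in>set ks. \<bar>\<Sum>i\<in>\<sigma> k ` S. \<delta>' k i * (marginal x k i - target k i)\<bar>)"
        by (rule sum_abs)
      also have "\<dots> \<le> (\<Sum>k\<in>set ks. \<Sum>i\<in>\<sigma> k ` S. \<bar>\<delta>' k i * (marginal x k i - target k i)\<bar>)"
        by (intro sum_mono sum_abs)
      also have "\<dots> \<le> (\<Sum>k\<in>set ks. \<Sum>i\<in>\<sigma> k ` S. (C * N) * \<bar>marginal x k i - target k i\<bar>)"
        unfolding abs_mult using d2 by (intro sum_mono mult_right_mono) auto
      also have "\<dots> = C * N * residual x" by (simp add: residual_def sum_distrib_left)
      finally show ?thesis .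
    qed
    have "N\<^sup>2 \<le> real (card S) * (\<Sum>s\<in>S. (\<eta> s)\<^sup>2)" unfolding N_def by (rule sum_abs_squared_le)
    also have "\<dots> \<le> (real (card S) + 1) * (\<Sum>s\<in>S. (\<eta> s)\<^sup>2)" by (intro mult_right_mono sum_nonneg) auto
    finally have N2: "h * N\<^sup>2 \<le> h * (real (card S) + 1) * (\<Sum>s\<in>S. (\<eta> s)\<^sup>2)" using h by simp
    have "(\<Sum>s\<in>S. q s * (exp (expo x s) - 1) * \<eta> s) + h * (real (card S) + 1) * (\<Sum>s\<in>S. (\<eta> s)\<^sup>2)
        \<le> potential x' - potential x"
      unfolding potential_def sum_subtractf[symmetric] sum_distrib_left sum.distrib[symmetric]
      by (intro sum_mono quad)
    then have "potential x - potential x' \<le> C * N * residual x - h * N\<^sup>2" using lin N2 by linarith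
    also have "\<dots> \<le> C\<^sup>2 / (4 * h) * (residual x)\<^sup>2"
    proof -
      \<comment> \<open>Completing the square in \<open>N\<close>.\<close>
      have "0 \<le> (2 * h * N - C * residual x)\<^sup>2" by simp
      then have "4 * h * (C * N * residual x - h * N\<^sup>2) \<le> C\<^sup>2 * (residual x)\<^sup>2"
        by (simp add: power2_eq_square algebra_simps)
      then show ?thesis using h by (simp add: field_simps)
    qed
    finally show ?thesis .
  qed
  then show ?thesis using h by (intro exI[of _ "C\<^sup>2 / (4 * h)"]) auto
qed

text \<open>Residual, path length and square root of the decrease form an increasing chain up to
constants; inserted into the gradient domination this bounds the gap by the decrease.  The point \<open>x'\<close>
may be arbitrary, since outside the level set it cannot lie below \<open>x\<close>.\<close>
lemma pass_decrease:
  "\<exists>K\<ge>1. \<forall>x. potential x \<le> c \<longrightarrow>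
     (path_length ks x)\<^sup>2 \<le> K * (potential x - potential (fold rescale ks x)) \<and>
     (\<forall>x'. potential x - potential x' \<le> K * (potential x - potential (fold rescale ks x)))"
proof -
  obtain B where B: "B \<ge> 0" "\<And>x k. potential x \<le> c \<Longrightarrow> k \<in> set ks \<Longrightarrow>
     (step_size k x)\<^sup>2 \<le> B * (potential x - potential (rescale k x))"
    using step_squared_le_decrease[of c] by blast
  obtain L where L: "L \<ge> 0" "\<And>x. potential x \<le> c \<Longrightarrow> residual x \<le> L * path_length ks x"
    using residual_le_path_length[of c] by blast
  obtain K where K: "K \<ge> 0" "\<And>x x'. potential x \<le> c \<Longrightarrow> potential x' \<le> c \<Longrightarrow>
      potential x - potential x' \<le> K * (residual x)\<^sup>2"
    using gradient_domination[of c] by blast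
  define B' where "B' = (real (length ks))\<^sup>2 * B"
  \<comment> \<open>At least 1 so that \<open>1 - 1 / K'\<close> is a contraction factor in \<open>[0, 1)\<close>.\<close>
  define K' where "K' = max 1 (max B' (K * L\<^sup>2 * B'))"
  have "(path_length ks x)\<^sup>2 \<le> K' * (potential x - potential (fold rescale ks x)) \<and>
     potential x - potential x' \<le> K' * (potential x - potential (fold rescale ks x))"
    if x: "potential x \<le> c" for x x'
  proof -
    let ?d = "potential x - potential (fold rescale ks x)"
    have d: "?d \<ge> 0" using potential_fold_le[of ks x] by simp
    have "(path_length ks x)\<^sup>2 \<le> (real (length ks) * sqrt (B * ?d))\<^sup>2"
      using path_length_le_decrease[OF B, where l = ks and x = x] x path_length_nonneg by (intro power_mono) auto
    also have "\<dots> = B' * ?d" using d B(1) by (simp add: B'_def power_mult_distrib)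
    finally have p: "(path_length ks x)\<^sup>2 \<le> B' * ?d" .
    have "B' * ?d \<le> K' * ?d" using d by (intro mult_right_mono) (auto simp: K'_def)
    moreover have "potential x - potential x' \<le> K' * ?d"
    proof (cases "potential x' \<le> c")
      case True
      have "(residual x)\<^sup>2 \<le> (L * path_length ks x)\<^sup>2"
        using L(2)[OF x] by (intro power_mono) (auto simp: residual_def sum_nonneg)
      also have "\<dots> \<le> L\<^sup>2 * (B' * ?d)" using p by (simp add: power_mult_distrib mult_left_mono)
      finally have "K * (residual x)\<^sup>2 \<le> K * (L\<^sup>2 * (B' * ?d))" using K(1) by (rule mult_left_mono)
      also have "\<dots> = (K * L\<^sup>2 * B') * ?d" by simp
      also have "\<dots> \<le> K' * ?d" using d by (intro mult_right_mono) (auto simp: K'_def)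
      finally show ?thesis using K(2)[OF x True] by linarith
    next
      case False
      then have "potential x - potential x' \<le> 0" using x by linarith
      also have "0 \<le> K' * ?d" using d by (intro mult_nonneg_nonneg) (auto simp: K'_def)
      finally show ?thesis .
    qed
    ultimately show ?thesis using p by linarith
  qed
  then show ?thesis by (intro exI[of _ K']) (auto simp: K'_def)
qed

text \<open>The gap \<open>D r\<close> to the infimum contracts by \<open>1 - 1 / K\<close> in every pass.  The displacement in a pass is
bounded by the square root of the gap, which explains \<open>\<rho> = sqrt \<theta>\<close>; geometric displacements force
convergence of each coordinate.\<close>
theorem linear_convergence:
  "\<exists>x A \<rho>. (\<forall>x'. potential x \<le> potential x') \<and> 0 \<le> A \<and> 0 \<le> \<rho> \<and> \<rho> < 1 \<and>
     (\<forall>r. \<forall>k\<in>set ks. \<forall>i\<in>\<sigma> k ` S. \<bar>(fold rescale ks ^^ r) x0 k i - x k i\<bar> \<le> A * \<rho> ^ r)"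
proof -
  define X where "X r = (fold rescale ks ^^ r) x0" for r
  have X_Suc: "X (Suc r) = fold rescale ks (X r)" for r by (simp add: X_def)
  have X_level: "potential (X r) \<le> potential x0" for r
  proof (induction r)
    case (Suc r)
    then show ?case using potential_fold_le[of ks "X r"] by (simp add: X_Suc)
  qed (simp add: X_def)
  obtain K where K: "K \<ge> 1"
    "\<And>r. (path_length ks (X r))\<^sup>2 \<le> K * (potential (X r) - potential (X (Suc r)))"
    "\<And>r x'. potential (X r) - potential x' \<le> K * (potential (X r) - potential (X (Suc r)))"
    using pass_decrease[of "potential x0"] X_level unfolding X_Suc by blast
  define F where "F = (INF x. potential x)"
  have bdd: "bdd_below (range potential)" using potential_nonneg by (auto intro!: bdd_belowI)
  have F_le: "F \<le> potential x" for x unfolding F_def using bdd by (rule cINF_lower) simp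
  define \<theta> where "\<theta> = 1 - 1 / K"
  have \<theta>: "0 \<le> \<theta>" "\<theta> < 1" using K(1) by (auto simp: \<theta>_def)
  define D where "D r = potential (X r) - F" for r
  have D_nonneg: "0 \<le> D r" for r using F_le by (simp add: D_def)
  have D_Suc: "D (Suc r) \<le> \<theta> * D r" for r
  proof -
    have "potential (X r) - K * (potential (X r) - potential (X (Suc r))) \<le> F"
      unfolding F_def using K(3)[of r] by (intro cINF_greatest) (auto simp: algebra_simps)
    then have "D r \<le> K * (D r - D (Suc r))" by (simp add: D_def)
    then have "D r / K \<le> D r - D (Suc r)" using K(1) by (simp add: field_simps)
    then show ?thesis by (simp add: \<theta>_def left_diff_distrib)
  qed
  have D_le: "D r \<le> D 0 * \<theta> ^ r" for r
  proof (induction r)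
    case (Suc r)
    have "D (Suc r) \<le> \<theta> * D r" by (rule D_Suc)
    also have "\<dots> \<le> \<theta> * (D 0 * \<theta> ^ r)" using Suc \<theta> by (intro mult_left_mono)
    finally show ?case by (simp add: mult_ac)
  qed simp
  define \<rho> where "\<rho> = sqrt \<theta>"
  have \<rho>: "0 \<le> \<rho>" "\<rho> < 1" using \<theta> by (auto simp: \<rho>_def real_sqrt_lt_1_iff)
  define E where "E = sqrt (K * D 0)"
  have E: "E \<ge> 0" using K(1) D_nonneg by (simp add: E_def)
  have len: "path_length ks (X r) \<le> E * \<rho> ^ r" for r
  proof -
    have "(path_length ks (X r))\<^sup>2 \<le> K * (D r - D (Suc r))" using K(2)[of r] by (simp add: D_def)
    also have "\<dots> \<le> K * (D 0 * \<theta> ^ r)" using K(1) D_nonneg[of "Suc r"] D_le[of r] by (intro mult_left_mono) auto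
    finally have "path_length ks (X r) \<le> sqrt (K * (D 0 * \<theta> ^ r))" by (rule real_le_rsqrt)
    then show ?thesis by (simp add: E_def \<rho>_def real_sqrt_mult real_sqrt_power)
  qed
  have "\<exists>l. \<forall>r. \<bar>X r k i - l\<bar> \<le> E / (1 - \<rho>) * \<rho> ^ r" if "i \<in> \<sigma> k ` S" for k i
  proof (rule geometric_steps_limit[OF \<rho>])
    show "\<bar>X (Suc r) k i - X r k i\<bar> \<le> E * \<rho> ^ r" for r
      using coordinate_moves_le[OF that, of ks "X r"] len[of r] by (simp add: X_Suc)
  qed
  then have "\<forall>k i. \<exists>l. i \<in> \<sigma> k ` S \<longrightarrow> (\<forall>r. \<bar>X r k i - l\<bar> \<le> E / (1 - \<rho>) * \<rho> ^ r)" by blast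
  then obtain x where x: "\<And>k i r. i \<in> \<sigma> k ` S \<Longrightarrow> \<bar>X r k i - x k i\<bar> \<le> E / (1 - \<rho>) * \<rho> ^ r"
    unfolding choice_iff by blast
  have \<rho>_lim: "(\<lambda>r. A * \<rho> ^ r) \<longlonglongrightarrow> 0" for A
    using tendsto_mult_right_zero[OF LIMSEQ_power_zero[of \<rho>]] \<rho> by simp
  have lim: "(\<lambda>r. X r k i) \<longlonglongrightarrow> x k i" if "i \<in> \<sigma> k ` S" for k i
    using x[OF that] by (intro LIM_zero_cancel[OF Lim_null_comparison[OF _ \<rho>_lim[of "E / (1 - \<rho>)"]]]) auto
  have "(\<lambda>r. potential (X r)) \<longlonglongrightarrow> potential x"
    unfolding potential_def expo_def by (intro tendsto_intros lim) auto
  moreover have "(\<lambda>r. potential (X r)) \<longlonglongrightarrow> F"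
  proof (rule LIM_zero_cancel, rule Lim_null_comparison)
    show "\<forall>\<^sub>F r in sequentially. norm (potential (X r) - F) \<le> D 0 * \<theta> ^ r"
      using D_nonneg D_le by (auto simp: D_def)
    show "(\<lambda>r. D 0 * \<theta> ^ r) \<longlonglongrightarrow> 0"
      using tendsto_mult_right_zero[OF LIMSEQ_power_zero[of \<theta>]] \<theta> by simp
  qed
  ultimately have "potential x = F" by (rule LIMSEQ_unique)
  then show ?thesis using F_le x \<rho> E unfolding X_def
    by (intro exI[of _ x] exI[of _ "E / (1 - \<rho>)"] exI[of _ \<rho>]) auto
qed

end

section \<open>Path sums on a chain by message passing\<close>
definition chain_weight ::
  "(nat \<Rightarrow> 'q \<Rightarrow> real) \<Rightarrow> ('q \<Rightarrow> 'q \<Rightarrow> real) \<Rightarrow> nat \<Rightarrow> (nat \<Rightarrow> 'q) \<Rightarrow> real" where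
  "chain_weight \<kappa> \<tau> T s = (\<Prod>t=1..T. \<kappa> t (s t)) * (\<Prod>t=1..<T. \<tau> (s t) (s (t + 1)))"

text \<open>Argument \<open>d\<close> yields the forward message at time \<open>d + 1\<close>.\<close>
primrec forward_msg ::
  "'q set \<Rightarrow> (nat \<Rightarrow> 'q \<Rightarrow> real) \<Rightarrow> ('q \<Rightarrow> 'q \<Rightarrow> real) \<Rightarrow> nat \<Rightarrow> 'q \<Rightarrow> real" where
  "forward_msg I \<kappa> \<tau> 0 = (\<lambda>_. 1)"
| "forward_msg I \<kappa> \<tau> (Suc d) = (\<lambda>r. \<Sum>q\<in>I. forward_msg I \<kappa> \<tau> d q * \<kappa> (Suc d) q * \<tau> q r)"

lemma forward_msg_cong:
  assumes "\<And>t q. t \<in> {1..d} \<Longrightarrow> q \<in> I \<Longrightarrow> \<kappa> t q = \<kappa>' t q"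
  shows "forward_msg I \<kappa> \<tau> d = forward_msg I \<kappa>' \<tau> d"
  using assms by (induction d) auto

lemma sum_PiE_Suc:
  fixes h :: "(nat \<Rightarrow> 'q) \<Rightarrow> real"
  shows "(\<Sum>s\<in>PiE {1..Suc t} (\<lambda>_. I). h s) = (\<Sum>s\<in>PiE {1..t} (\<lambda>_. I). \<Sum>r\<in>I. h (s(Suc t := r)))"
proof -
  have "{1..Suc t} = insert (Suc t) {1..t}" by auto
  then have "(\<Sum>s\<in>PiE {1..Suc t} (\<lambda>_. I). h s)
      = (\<Sum>s\<in>(\<lambda>(y, g). g(Suc t := y)) ` (I \<times> PiE {1..t} (\<lambda>_. I)). h s)"
    by (simp only: PiE_insert_eq)
  also have "\<dots> = (\<Sum>(r, s)\<in>I \<times> PiE {1..t} (\<lambda>_. I). h (s(Suc t := r)))"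
    by (subst sum.reindex) (auto intro: inj_combinator simp: case_prod_beta)
  also have "\<dots> = (\<Sum>s\<in>PiE {1..t} (\<lambda>_. I). \<Sum>r\<in>I. h (s(Suc t := r)))"
    by (subst sum.swap) (simp add: sum.cartesian_product)
  finally show ?thesis .
qed

lemma chain_weight_extend:
  assumes "1 \<le> t"
  shows "chain_weight \<kappa> \<tau> (Suc t) (s(Suc t := r)) = chain_weight \<kappa> \<tau> t s * \<kappa> (Suc t) r * \<tau> (s t) r"
proof -
  have 1: "(\<Prod>t'=1..t. \<kappa> t' ((s(Suc t := r)) t')) = (\<Prod>t'=1..t. \<kappa> t' (s t'))"
    by (intro prod.cong) auto
  have 2: "(\<Prod>t'=1..<t. \<tau> ((s(Suc t := r)) t') ((s(Suc t := r)) (t' + 1))) = (\<Prod>t'=1..<t. \<tau> (s t') (s (t' + 1)))"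
    by (intro prod.cong) auto
  show ?thesis
    using assms unfolding chain_weight_def
    by (simp only: prod.atLeastLessThan_Suc prod.nat_ivl_Suc' 1 2) (simp add: mult_ac)
qed

lemma chain_prefix_sum:
  assumes "1 \<le> t"
  shows "(\<Sum>s\<in>PiE {1..t} (\<lambda>_. I). chain_weight \<kappa> \<tau> t s * g (s t))
       = (\<Sum>q\<in>I. forward_msg I \<kappa> \<tau> (t - 1) q * \<kappa> t q * g q)"
  using assms
proof (induction t arbitrary: g rule: dec_induct)
  case base
  show ?case
    using sum_PiE_Suc[of "\<lambda>s. chain_weight \<kappa> \<tau> 1 s * g (s 1)" 0 I] by (simp add: chain_weight_def)
next
  case (step t)
  have "(\<Sum>s\<in>PiE {1..Suc t} (\<lambda>_. I). chain_weight \<kappa> \<tau> (Suc t) s * g (s (Suc t)))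
      = (\<Sum>s\<in>PiE {1..t} (\<lambda>_. I). chain_weight \<kappa> \<tau> t s * (\<Sum>r\<in>I. \<kappa> (Suc t) r * \<tau> (s t) r * g r))"
    unfolding sum_PiE_Suc using step.hyps
    by (simp add: chain_weight_extend sum_distrib_left mult_ac)
  also have "\<dots> = (\<Sum>q\<in>I. forward_msg I \<kappa> \<tau> (t - 1) q * \<kappa> t q * (\<Sum>r\<in>I. \<kappa> (Suc t) r * \<tau> q r * g r))"
    by (rule step.IH)
  also have "\<dots> = (\<Sum>r\<in>I. \<Sum>q\<in>I. forward_msg I \<kappa> \<tau> (t - 1) q * \<kappa> t q * (\<kappa> (Suc t) r * \<tau> q r * g r))"
    unfolding sum_distrib_left by (rule sum.swap)
  also have "\<dots> = (\<Sum>r\<in>I. forward_msg I \<kappa> \<tau> t r * \<kappa> (Suc t) r * g r)"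
    using step.hyps by (cases t) (simp_all add: sum_distrib_left sum_distrib_right mult_ac)
  finally show ?case by simp
qed

text \<open>The backward messages \<open>\<beta>\<close> are required to satisfy their recursion only from time \<open>t\<close> on, where the
recursion reads the kernels of times after \<open>t\<close>.  During a pass of the algorithm exactly these
kernels still agree with the ones from which the messages were computed.  The proof eliminates the
times \<open>T\<close>, \<open>T - 1\<close>, ... after \<open>t\<close> one by one and then sums the prefix that ends at \<open>t\<close>.\<close>
lemma chain_marginal:
  assumes t: "1 \<le> t" "t \<le> T"
    and last: "\<And>q. q \<in> I \<Longrightarrow> \<beta> T q = 1"
    and rec: "\<And>t' q. t \<le> t' \<Longrightarrow> t' < T \<Longrightarrow> q \<in> I \<Longrightarrow>
        \<beta> t' q = (\<Sum>r\<in>I. \<beta> (Suc t') r * \<kappa> (Suc t') r * \<tau> q r)"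
  shows "(\<Sum>s\<in>PiE {1..T} (\<lambda>_. I). chain_weight \<kappa> \<tau> T s * g (s t))
       = (\<Sum>q\<in>I. forward_msg I \<kappa> \<tau> (t - 1) q * \<kappa> t q * \<beta> t q * g q)"
proof -
  have "(\<Sum>s\<in>PiE {1..T} (\<lambda>_. I). chain_weight \<kappa> \<tau> T s * g (s t))
      = (\<Sum>s\<in>PiE {1..t'} (\<lambda>_. I). chain_weight \<kappa> \<tau> t' s * \<beta> t' (s t') * g (s t))"
    if "t' \<le> T" "t \<le> t'" for t'
    using that
  proof (induction t' rule: inc_induct)
    case base
    show ?case
    proof (rule sum.cong[OF refl])
      fix s assume "s \<in> PiE {1..T} (\<lambda>_. I)"
      then have "s T \<in> I" using t by (intro PiE_mem[of s "{1..T}"]) auto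
      then show "chain_weight \<kappa> \<tau> T s * g (s t) = chain_weight \<kappa> \<tau> T s * \<beta> T (s T) * g (s t)"
        by (simp add: last)
    qed
  next
    case (step t')
    have "(\<Sum>s\<in>PiE {1..T} (\<lambda>_. I). chain_weight \<kappa> \<tau> T s * g (s t))
      = (\<Sum>s\<in>PiE {1..Suc t'} (\<lambda>_. I). chain_weight \<kappa> \<tau> (Suc t') s * \<beta> (Suc t') (s (Suc t')) * g (s t))"
      using step by simp
    also have "\<dots> = (\<Sum>s\<in>PiE {1..t'} (\<lambda>_. I). chain_weight \<kappa> \<tau> t' s * \<beta> t' (s t') * g (s t))"
      unfolding sum_PiE_Suc
    proof (rule sum.cong[OF refl])
      fix s assume "s \<in> PiE {1..t'} (\<lambda>_. I)"
      then have "s t' \<in> I" using step.hyps step.prems t by (intro PiE_mem[of s "{1..t'}"]) auto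
      moreover have "1 \<le> t'" "t \<le> t'" "t' < T" using step.hyps step.prems t by auto
      ultimately show "(\<Sum>r\<in>I. chain_weight \<kappa> \<tau> (Suc t') (s(Suc t' := r)) * \<beta> (Suc t') ((s(Suc t' := r)) (Suc t')) *
              g ((s(Suc t' := r)) t)) = chain_weight \<kappa> \<tau> t' s * \<beta> t' (s t') * g (s t)"
        by (simp add: chain_weight_extend rec sum_distrib_left sum_distrib_right mult_ac)
    qed
    finally show ?case .
  qed
  from this[of t] t have "(\<Sum>s\<in>PiE {1..T} (\<lambda>_. I). chain_weight \<kappa> \<tau> T s * g (s t))
      = (\<Sum>s\<in>PiE {1..t} (\<lambda>_. I). chain_weight \<kappa> \<tau> t s * (\<beta> t (s t) * g (s t)))"
    by (simp add: mult.assoc)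
  also have "\<dots> = (\<Sum>q\<in>I. forward_msg I \<kappa> \<tau> (t - 1) q * \<kappa> t q * (\<beta> t q * g q))"
    by (rule chain_prefix_sum[OF t(1)])
  finally show ?thesis by (simp add: mult.assoc)
qed

section \<open>Chains of constant row index\<close>
lemma sum_mu_bar: "(\<Sum>i=1..m+1. mu_bar m n i) = real (m + n)"
  by (simp add: mu_bar_def)

lemma sum_mu_tilde: "(\<Sum>j=1..n+1. mu_tilde m n j) = real (m + n)"
  by (simp add: mu_tilde_def)

text \<open>The transitions of positive weight are those within a row.  This support is what makes the product of
the marginals, restricted to constant rows, a feasible tensor that is positive on every path of positive
weight.\<close>
locale row_preserving_chain =
  fixes T m n :: nat and k :: "nat \<Rightarrow> nat \<times> nat \<Rightarrow> real" and kh :: "nat \<times> nat \<Rightarrow> nat \<times> nat \<Rightarrow> real"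
  assumes T: "T \<ge> 1" and m: "m \<ge> 1" and n: "n \<ge> 1"
    and k_pos: "k t r > 0"
    and kh_pos: "fst r = fst r' \<Longrightarrow> kh r r' > 0"
    and kh_zero: "fst r \<noteq> fst r' \<Longrightarrow> kh r r' = 0"
begin

abbreviation "idx \<equiv> pair_indices m n"
abbreviation "\<mu> \<equiv> mu_bar m n"
abbreviation "\<nu> \<equiv> mu_tilde m n"

definition row_paths :: "(nat \<Rightarrow> nat \<times> nat) set" where
  "row_paths = {s \<in> tensor_indices T m n. \<forall>t\<in>{1..<T}. fst (s t) = fst (s (t + 1))}"

text \<open>The product of the marginals, written as the kernel of a chain: the row is drawn at time 1 and kept,
the columns are drawn independently at every time.  Both marginals have total mass \<open>m + n\<close>, so each
column factor is normalised and the total mass \<open>m + n\<close> sits in the row factor.\<close>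
definition coupling_kernel :: "nat \<Rightarrow> nat \<times> nat \<Rightarrow> real" where
  "coupling_kernel t r = (if t = 1 then \<mu> (fst r) else 1) * (\<nu> (snd r) / real (m + n))"

abbreviation coupling :: "(nat \<Rightarrow> nat \<times> nat) \<Rightarrow> real" where
  "coupling \<equiv> chain_weight coupling_kernel (\<lambda>r r'. of_bool (fst r = fst r')) T"

text \<open>Chosen so that \<open>coupling s * exp (offset s)\<close> is the weight of \<open>s\<close> at zero multipliers, which brings the
dual objective into the form of a potential with \<open>q\<close> the coupling.\<close>
definition offset :: "(nat \<Rightarrow> nat \<times> nat) \<Rightarrow> real" where
  "offset s = ln (chain_weight k kh T s / coupling s)"

text \<open>The flag tells column multipliers (\<open>True\<close>) from row multipliers (\<open>False\<close>); the order of the list is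
the order of the updates.\<close>
definition blocks :: "(nat \<times> bool) list" where
  "blocks = concat (map (\<lambda>t. [(t, False), (t, True)]) [1..<T+1])"

definition entry :: "nat \<times> bool \<Rightarrow> (nat \<Rightarrow> nat \<times> nat) \<Rightarrow> nat" where
  "entry = (\<lambda>(t, b) s. if b then snd (s t) else fst (s t))"

definition scaled_kernel :: "(nat \<times> bool \<Rightarrow> nat \<Rightarrow> real) \<Rightarrow> nat \<Rightarrow> nat \<times> nat \<Rightarrow> real" where
  "scaled_kernel x t r = k t r * exp (x (t, False) (fst r)) * exp (x (t, True) (snd r))"

lemma entry_simps [simp]: "entry (t, False) s = fst (s t)" "entry (t, True) s = snd (s t)"
  by (simp_all add: entry_def)

lemma set_blocks: "set blocks = {1..T} \<times> UNIV"
  by (auto simp: blocks_def)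

lemma sum_blocks: "(\<Sum>b\<in>set blocks. f b) = (\<Sum>t=1..T. f (t, False)) + (\<Sum>t=1..T. f (t, True))"
  for f :: "nat \<times> bool \<Rightarrow> real"
  unfolding set_blocks by (simp add: sum.cartesian_product' UNIV_bool sum.distrib add.commute)

lemma finite_idx: "finite idx"
  by (simp add: pair_indices_def)

lemma sum_idx: "(\<Sum>r\<in>idx. f r) = (\<Sum>i=1..m+1. \<Sum>j=1..n+1. f (i, j))" for f :: "nat \<times> nat \<Rightarrow> real"
  by (simp only: pair_indices_def sum.cartesian_product case_prod_eta)

lemma mu_pos: "\<mu> i > 0" "\<nu> j > 0"
  using m n by (auto simp: mu_bar_def mu_tilde_def)

lemma finite_tensor: "finite (tensor_indices T m n)"
  using finite_idx by (simp add: tensor_indices_def finite_PiE)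

lemma finite_row_paths: "finite row_paths"
  using finite_tensor by (simp add: row_paths_def)

lemma chain_weight_pos:
  assumes "s \<in> row_paths" "\<And>t r. \<kappa> t r > 0" "\<And>r r'. fst r = fst r' \<Longrightarrow> \<tau> r r' > 0"
  shows "chain_weight \<kappa> \<tau> T s > 0"
  unfolding chain_weight_def using assms(1)
  by (intro mult_pos_pos prod_pos assms(2,3)) (simp add: row_paths_def)

lemma chain_weight_zero:
  assumes "s \<in> tensor_indices T m n - row_paths" "\<And>r r'. fst r \<noteq> fst r' \<Longrightarrow> \<tau> r r' = 0"
  shows "chain_weight \<kappa> \<tau> T s = 0"
proof -
  obtain t where t: "t \<in> {1..<T}" "fst (s t) \<noteq> fst (s (t + 1))"
    using assms(1) by (auto simp: row_paths_def)
  have "(\<Prod>t=1..<T. \<tau> (s t) (s (t + 1))) = 0"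
    using t(1) assms(2)[OF t(2)] by (intro prod_zero) auto
  then show ?thesis by (simp add: chain_weight_def)
qed

lemma coupling_kernel_pos: "coupling_kernel t r > 0"
  using m mu_pos by (simp add: coupling_kernel_def)

lemma coupling_pos: "s \<in> row_paths \<Longrightarrow> coupling s > 0"
  by (rule chain_weight_pos) (auto simp: coupling_kernel_pos)

lemma sum_row_paths:
  assumes "\<And>r r'. fst r \<noteq> fst r' \<Longrightarrow> \<tau> r r' = 0"
  shows "(\<Sum>s\<in>row_paths. chain_weight \<kappa> \<tau> T s * h s) = (\<Sum>s\<in>tensor_indices T m n. chain_weight \<kappa> \<tau> T s * h s)"
  using assms by (intro sum.mono_neutral_left finite_tensor) (auto simp: row_paths_def chain_weight_zero)

lemma sum_normalised_row: "(\<Sum>r\<in>idx. f (fst r) * \<nu> (snd r) / real (m + n) * of_bool (i = fst r)) = f i"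
  if "i \<in> {1..m+1}" for f :: "nat \<Rightarrow> real"
proof -
  have "(\<Sum>r\<in>idx. f (fst r) * \<nu> (snd r) / real (m + n) * of_bool (i = fst r))
      = (\<Sum>i'=1..m+1. of_bool (i = i') * (f i' / real (m + n) * (\<Sum>j=1..n+1. \<nu> j)))"
    unfolding sum_idx sum_distrib_left by (intro sum.cong refl) (simp add: mult_ac)
  also have "\<dots> = (\<Sum>i'=1..m+1. if i' = i then f i' else 0)"
    unfolding sum_mu_tilde using m by (intro sum.cong) (auto simp: field_simps)
  also have "\<dots> = f i" using that by simp
  finally show ?thesis .
qed

text \<open>The messages of the coupling chain are explicit: the backward ones are 1 as the column factors are
normalised, and after time 1 the forward ones carry the row factor.\<close>
lemma coupling_pair_marginal:
  assumes t: "t \<in> {1..T}"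
  shows "(\<Sum>s\<in>row_paths. coupling s * g (s t)) = (\<Sum>r\<in>idx. \<mu> (fst r) * \<nu> (snd r) / real (m + n) * g r)"
proof -
  let ?\<tau> = "\<lambda>r r'. of_bool (fst r = fst r') :: real"
  have fw: "forward_msg idx coupling_kernel ?\<tau> d r = (if d = 0 then 1 else \<mu> (fst r))" if "r \<in> idx" for d r
    using that
  proof (induction d arbitrary: r)
    case (Suc d)
    have "fst r \<in> {1..m+1}" using Suc.prems by (auto simp: pair_indices_def)
    have "forward_msg idx coupling_kernel ?\<tau> (Suc d) r
        = (\<Sum>r'\<in>idx. \<mu> (fst r') * \<nu> (snd r') / real (m + n) * of_bool (fst r = fst r'))"
      unfolding forward_msg.simps
      by (intro sum.cong refl) (simp add: Suc.IH coupling_kernel_def eq_commute[of "fst r"])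
    then show ?case using sum_normalised_row[OF \<open>fst r \<in> _\<close>, of \<mu>] by simp
  qed simp
  have "(\<Sum>s\<in>row_paths. coupling s * g (s t)) = (\<Sum>s\<in>PiE {1..T} (\<lambda>_. idx). coupling s * g (s t))"
    using sum_row_paths[of ?\<tau> coupling_kernel "\<lambda>s. g (s t)"] by (simp add: tensor_indices_def)
  also have "\<dots> = (\<Sum>r\<in>idx. forward_msg idx coupling_kernel ?\<tau> (t - 1) r * coupling_kernel t r * 1 * g r)"
  proof (rule chain_marginal)
    fix t' r assume "t \<le> t'" "r \<in> idx"
    then have "fst r \<in> {1..m+1}" by (auto simp: pair_indices_def)
    show "1 = (\<Sum>r'\<in>idx. 1 * coupling_kernel (Suc t') r' * ?\<tau> r r')"
      using sum_normalised_row[OF \<open>fst r \<in> _\<close>, of "\<lambda>_. 1"] t \<open>t \<le> t'\<close> by (simp add: coupling_kernel_def)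
  qed (use t in auto)
  also have "\<dots> = (\<Sum>r\<in>idx. \<mu> (fst r) * \<nu> (snd r) / real (m + n) * g r)"
    using t by (intro sum.cong) (auto simp: fw coupling_kernel_def)
  finally show ?thesis .
qed

lemma constant_row_path:
  assumes "i \<in> {1..m+1}" "\<And>t. t \<in> {1..T} \<Longrightarrow> j t \<in> {1..n+1}"
  shows "(\<lambda>t\<in>{1..T}. (i, j t)) \<in> row_paths"
  unfolding row_paths_def tensor_indices_def pair_indices_def using assms by simp

lemma row_path_range:
  assumes "s \<in> row_paths" "t \<in> {1..T}"
  shows "s t \<in> idx" "fst (s t) \<in> {1..m+1}" "snd (s t) \<in> {1..n+1}"
proof -
  show "s t \<in> idx"
    using assms by (intro PiE_mem[of s "{1..T}"]) (simp_all add: row_paths_def tensor_indices_def)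
  then show "fst (s t) \<in> {1..m+1}" "snd (s t) \<in> {1..n+1}" by (auto simp: pair_indices_def)
qed

lemma row_path_const:
  assumes "s \<in> row_paths" "t \<in> {1..T}"
  shows "fst (s t) = fst (s 1)"
proof -
  have "1 \<le> t" using assms by simp
  then show ?thesis using assms(2)
  proof (induction t rule: dec_induct)
    case (step t)
    then have "fst (s t) = fst (s (t + 1))" using assms(1) by (simp add: row_paths_def)
    then show ?case using step by simp
  qed simp
qed

lemma entry_image:
  assumes "t \<in> {1..T}"
  shows "entry (t, False) ` row_paths = {1..m+1}" "entry (t, True) ` row_paths = {1..n+1}"
proof -
  have "i \<in> entry (t, False) ` row_paths" if "i \<in> {1..m+1}" for i
    using constant_row_path[OF that, of "\<lambda>_. 1"] assms
    by (intro image_eqI[where x = "\<lambda>t\<in>{1..T}. (i, 1)"]) simp_all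
  then show "entry (t, False) ` row_paths = {1..m+1}"
    using row_path_range(2)[OF _ assms] by (intro equalityI subsetI) (auto simp del: atLeastAtMost_iff)
  have "j \<in> entry (t, True) ` row_paths" if "j \<in> {1..n+1}" for j
    using constant_row_path[of 1 "\<lambda>_. j"] that assms
    by (intro image_eqI[where x = "\<lambda>t\<in>{1..T}. (1, j)"]) simp_all
  then show "entry (t, True) ` row_paths = {1..n+1}"
    using row_path_range(3)[OF _ assms] by (intro equalityI subsetI) (auto simp del: atLeastAtMost_iff)
qed

text \<open>The row multipliers of different times act only through their sum, and a constant can be moved
between row and column multipliers.  The representative \<open>\<delta>'\<close> is normalised to have no row
part after time 1 and to vanish at column 1.  Its entries can then be read off from the exponents of
the path that stays at column 1 and of the paths that leave it at a single time.\<close>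
lemma gauge_fixing:
  fixes \<delta> :: "nat \<times> bool \<Rightarrow> nat \<Rightarrow> real"
  defines "\<eta> \<equiv> \<lambda>s. \<Sum>b\<in>set blocks. \<delta> b (entry b s)"
  shows "\<exists>\<delta>'. (\<forall>s\<in>row_paths. (\<Sum>b\<in>set blocks. \<delta>' b (entry b s)) = \<eta> s) \<and>
    (\<forall>b\<in>set blocks. \<forall>i\<in>entry b ` row_paths. \<bar>\<delta>' b i\<bar> \<le> 2 * (\<Sum>s\<in>row_paths. \<bar>\<eta> s\<bar>))"
proof -
  define N where "N = (\<Sum>s\<in>row_paths. \<bar>\<eta> s\<bar>)"
  \<comment> \<open>The path at column 1 in row \<open>i\<close>, and the path in row 1 that visits column \<open>j\<close> at time \<open>t\<close>.\<close>
  define e where "e i = (\<lambda>t\<in>{1..T}. (i :: nat, 1 :: nat))" for i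
  define e' where "e' t j = (\<lambda>t'\<in>{1..T}. (1 :: nat, if t' = t then j else 1 :: nat))" for t j
  define \<delta>' where "\<delta>' = (\<lambda>(t, b) i. if b then \<eta> (e' t i) - \<eta> (e 1) else if t = 1 then \<eta> (e i) else 0)"
  have \<eta>_le: "\<bar>\<eta> s\<bar> \<le> N" if "s \<in> row_paths" for s
    unfolding N_def using that finite_row_paths by (intro member_le_sum) auto
  have N: "N \<ge> 0" by (simp add: N_def sum_nonneg)
  have e_in: "e i \<in> row_paths" if "i \<in> {1..m+1}" for i
    unfolding e_def using that by (intro constant_row_path) auto
  have e'_in: "e' t j \<in> row_paths" if "j \<in> {1..n+1}" for t j
    unfolding e'_def using that by (intro constant_row_path) auto
  have \<eta>_split: "\<eta> s = (\<Sum>t=1..T. \<delta> (t, False) (fst (s t))) + (\<Sum>t=1..T. \<delta> (t, True) (snd (s t)))" for s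
    by (simp add: \<eta>_def sum_blocks)
  have \<eta>_e: "\<eta> (e i) = (\<Sum>t=1..T. \<delta> (t, False) i) + (\<Sum>t=1..T. \<delta> (t, True) 1)" for i
    unfolding \<eta>_split by (simp add: e_def)
  have \<eta>_diff: "\<eta> (e' t j) - \<eta> (e 1) = \<delta> (t, True) j - \<delta> (t, True) 1" if t: "t \<in> {1..T}" for t j
  proof -
    have "\<eta> (e' t j) - \<eta> (e 1)
        = (\<Sum>t'=1..T. \<delta> (t', True) (if t' = t then j else 1) - \<delta> (t', True) 1)"
      unfolding \<eta>_e unfolding \<eta>_split e'_def by (simp add: sum_subtractf)
    also have "\<dots> = (\<Sum>t'=1..T. if t' = t then \<delta> (t, True) j - \<delta> (t, True) 1 else 0)"
      by (intro sum.cong) auto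
    finally show ?thesis using t by simp
  qed
  have "(\<Sum>b\<in>set blocks. \<delta>' b (entry b s)) = \<eta> s" if s: "s \<in> row_paths" for s
  proof -
    have "(\<Sum>t=1..T. \<delta>' (t, False) (fst (s t))) = (\<Sum>t=1..T. if t = 1 then \<eta> (e (fst (s 1))) else 0)"
      by (intro sum.cong) (auto simp: \<delta>'_def)
    then have 1: "(\<Sum>t=1..T. \<delta>' (t, False) (fst (s t))) = \<eta> (e (fst (s 1)))" using T by simp
    have 2: "(\<Sum>t=1..T. \<delta>' (t, True) (snd (s t))) = (\<Sum>t=1..T. \<delta> (t, True) (snd (s t)) - \<delta> (t, True) 1)"
      by (intro sum.cong) (auto simp: \<delta>'_def \<eta>_diff[unfolded One_nat_def])
    have "(\<Sum>t=1..T. \<delta> (t, False) (fst (s t))) = (\<Sum>t=1..T. \<delta> (t, False) (fst (s 1)))"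
    proof (rule sum.cong[OF refl])
      fix t assume "t \<in> {1..T}"
      from row_path_const[OF s this] show "\<delta> (t, False) (fst (s t)) = \<delta> (t, False) (fst (s 1))" by (rule arg_cong)
    qed
    then show ?thesis
      unfolding sum_blocks entry_simps 1 2 \<eta>_e \<eta>_split[of s] by (simp add: sum_subtractf)
  qed
  moreover have "\<bar>\<delta>' b i\<bar> \<le> 2 * N" if b: "b \<in> set blocks" and i: "i \<in> entry b ` row_paths" for b i
  proof (cases b)
    case (Pair t c)
    then have t: "t \<in> {1..T}" using b by (simp add: set_blocks)
    show ?thesis
    proof (cases c)
      case True
      then have "i \<in> {1..n+1}" using i Pair entry_image(2)[OF t] by simp
      from \<eta>_le[OF e'_in[OF this, of t]] \<eta>_le[OF e_in[of 1]]
      have "\<bar>\<eta> (e' t i)\<bar> \<le> N" "\<bar>\<eta> (e 1)\<bar> \<le> N" by simp_all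
      then show ?thesis using Pair True by (simp add: \<delta>'_def)
    next
      case False
      then have "i \<in> {1..m+1}" using i Pair entry_image(1)[OF t] by simp
      from \<eta>_le[OF e_in[OF this]] show ?thesis using Pair False N by (simp add: \<delta>'_def)
    qed
  qed
  ultimately show ?thesis unfolding N_def by blast
qed

sublocale block_scaling row_paths coupling offset blocks entry 2
  using finite_row_paths coupling_pos gauge_fixing by unfold_locales auto

lemma coupling_exp_expo:
  assumes "s \<in> row_paths"
  shows "coupling s * exp (expo x s) = chain_weight (scaled_kernel x) kh T s"
proof -
  have "chain_weight k kh T s > 0" using assms k_pos kh_pos by (intro chain_weight_pos)
  then have "coupling s * exp (offset s) = chain_weight k kh T s"
    using coupling_pos[OF assms] by (simp add: offset_def)
  moreover have "exp (\<Sum>b\<in>set blocks. x b (entry b s))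
      = (\<Prod>t=1..T. exp (x (t, False) (fst (s t)))) * (\<Prod>t=1..T. exp (x (t, True) (snd (s t))))"
    by (simp add: sum_blocks exp_add exp_sum)
  moreover have "coupling s * exp (expo x s)
      = (coupling s * exp (offset s)) * exp (\<Sum>b\<in>set blocks. x b (entry b s))"
    by (simp only: expo_def exp_add mult.assoc)
  ultimately show ?thesis
    by (simp add: chain_weight_def scaled_kernel_def prod.distrib mult_ac)
qed

lemma target_rows: "t \<in> {1..T} \<Longrightarrow> i \<in> {1..m+1} \<Longrightarrow> target (t, False) i = \<mu> i"
proof -
  assume t: "t \<in> {1..T}" and i: "i \<in> {1..m+1}"
  have "target (t, False) i = (\<Sum>s\<in>row_paths. coupling s * of_bool (i = fst (s t)))"
    by (simp add: target_def sum_over_fibre eq_commute[of i])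
  then show ?thesis using coupling_pair_marginal[OF t, of "\<lambda>r. of_bool (i = fst r)"] sum_normalised_row[OF i, of \<mu>] by simp
qed

lemma target_columns: "t \<in> {1..T} \<Longrightarrow> j \<in> {1..n+1} \<Longrightarrow> target (t, True) j = \<nu> j"
proof -
  assume t: "t \<in> {1..T}" and j: "j \<in> {1..n+1}"
  have "target (t, True) j = (\<Sum>s\<in>row_paths. coupling s * of_bool (j = snd (s t)))"
    by (simp add: target_def sum_over_fibre eq_commute[of j])
  also have "\<dots> = (\<Sum>i=1..m+1. \<Sum>j'=1..n+1. \<mu> i * \<nu> j' / real (m + n) * of_bool (j = j'))"
    using coupling_pair_marginal[OF t, of "\<lambda>r. of_bool (j = snd r)"] by (simp add: sum_idx)
  also have "\<dots> = (\<Sum>i=1..m+1. \<mu> i) * (\<nu> j / real (m + n))"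
    unfolding sum_distrib_right
  proof (rule sum.cong[OF refl])
    fix i
    have "(\<Sum>j'=1..n+1. \<mu> i * \<nu> j' / real (m + n) * of_bool (j = j'))
        = (\<Sum>j'=1..n+1. if j' = j then \<mu> i * \<nu> j / real (m + n) else 0)"
      by (intro sum.cong) auto
    then show "(\<Sum>j'=1..n+1. \<mu> i * \<nu> j' / real (m + n) * of_bool (j = j')) = \<mu> i * (\<nu> j / real (m + n))"
      using j by simp
  qed
  finally show ?thesis unfolding sum_mu_bar using m by simp
qed

text \<open>Up to sign and a constant, the potential is the dual objective in the scaled multipliers.\<close>
lemma potential_dual:
  "potential x = (\<Sum>s\<in>tensor_indices T m n. chain_weight (scaled_kernel x) kh T s)
    - (\<Sum>t=1..T. \<Sum>i=1..m+1. \<mu> i * x (t, False) i) - (\<Sum>t=1..T. \<Sum>j=1..n+1. \<nu> j * x (t, True) j)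
    - (\<Sum>s\<in>row_paths. coupling s * offset s)"
proof -
  have "potential x = (\<Sum>s\<in>row_paths. chain_weight (scaled_kernel x) kh T s)
      - (\<Sum>s\<in>row_paths. coupling s * (\<Sum>b\<in>set blocks. x b (entry b s)))
      - (\<Sum>s\<in>row_paths. coupling s * offset s)"
    unfolding potential_def sum_subtractf[symmetric]
    by (intro sum.cong refl) (simp add: right_diff_distrib coupling_exp_expo, simp add: expo_def algebra_simps)
  also have "(\<Sum>s\<in>row_paths. chain_weight (scaled_kernel x) kh T s)
      = (\<Sum>s\<in>tensor_indices T m n. chain_weight (scaled_kernel x) kh T s)"
    using sum_row_paths[of kh "scaled_kernel x" "\<lambda>_. 1"] kh_zero by simp
  also have "(\<Sum>s\<in>row_paths. coupling s * (\<Sum>b\<in>set blocks. x b (entry b s)))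
      = (\<Sum>t=1..T. \<Sum>i=1..m+1. \<mu> i * x (t, False) i) + (\<Sum>t=1..T. \<Sum>j=1..n+1. \<nu> j * x (t, True) j)"
    unfolding sum_pairing target_def[symmetric] unfolding sum_blocks
    by (intro arg_cong2[of _ _ _ _ "(+)"] sum.cong refl)
      (simp_all only: entry_image target_rows target_columns mult.commute)
  finally show ?thesis by simp
qed

lemma marginal_by_messages:
  assumes t: "t \<in> {1..T}"
    and last: "\<forall>r\<in>idx. \<beta> T r = 1"
    and rec: "\<forall>t'\<in>{t..<T}. \<forall>r\<in>idx.
        \<beta> t' r = (\<Sum>r'\<in>idx. \<beta> (Suc t') r' * scaled_kernel x (Suc t') r' * kh r r')"
  defines "\<pi> \<equiv> \<lambda>r. forward_msg idx (scaled_kernel x) kh (t - 1) r * scaled_kernel x t r * \<beta> t r"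
  shows "i \<in> {1..m+1} \<Longrightarrow> marginal x (t, False) i = (\<Sum>j=1..n+1. \<pi> (i, j))"
    and "j \<in> {1..n+1} \<Longrightarrow> marginal x (t, True) j = (\<Sum>i=1..m+1. \<pi> (i, j))"
proof -
  have pm: "(\<Sum>s\<in>row_paths. chain_weight (scaled_kernel x) kh T s * g (s t)) = (\<Sum>r\<in>idx. \<pi> r * g r)" for g
  proof -
    have "(\<Sum>s\<in>row_paths. chain_weight (scaled_kernel x) kh T s * g (s t))
        = (\<Sum>s\<in>tensor_indices T m n. chain_weight (scaled_kernel x) kh T s * g (s t))"
      using sum_row_paths[of kh "scaled_kernel x" "\<lambda>s. g (s t)"] kh_zero by blast
    also have "\<dots> = (\<Sum>r\<in>idx. \<pi> r * g r)"
      unfolding tensor_indices_def \<pi>_def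
    proof (rule chain_marginal[where \<beta> = \<beta> and \<kappa> = "scaled_kernel x" and \<tau> = kh
          and t = t and g = g and T = T and I = idx])
      show "\<beta> T r = 1" if "r \<in> idx" for r using last that by blast
      show "\<beta> t' r = (\<Sum>r'\<in>idx. \<beta> (Suc t') r' * scaled_kernel x (Suc t') r' * kh r r')"
        if "t \<le> t'" "t' < T" "r \<in> idx" for t' r
        using that by (intro rec[rule_format]) simp_all
    qed (use t in \<open>simp_all only: atLeastAtMost_iff\<close>)
    finally show ?thesis .
  qed
  have ind: "marginal x b i = (\<Sum>s\<in>row_paths. chain_weight (scaled_kernel x) kh T s * of_bool (entry b s = i))" for b i
    unfolding marginal_def sum_over_fibre by (simp add: coupling_exp_expo)
  show "marginal x (t, False) i = (\<Sum>j=1..n+1. \<pi> (i, j))" if i: "i \<in> {1..m+1}"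
  proof -
    have "marginal x (t, False) i = (\<Sum>i'=1..m+1. \<Sum>j=1..n+1. \<pi> (i', j) * of_bool (i' = i))"
      using pm[of "\<lambda>r. of_bool (fst r = i)"] by (simp add: ind sum_idx)
    also have "\<dots> = (\<Sum>i'=1..m+1. if i' = i then \<Sum>j=1..n+1. \<pi> (i, j) else 0)"
      by (intro sum.cong) auto
    finally show ?thesis using i by simp
  qed
  show "marginal x (t, True) j = (\<Sum>i=1..m+1. \<pi> (i, j))" if j: "j \<in> {1..n+1}"
  proof -
    have "marginal x (t, True) j = (\<Sum>i=1..m+1. \<Sum>j'=1..n+1. \<pi> (i, j') * of_bool (j' = j))"
      using pm[of "\<lambda>r. of_bool (snd r = j)"] by (simp add: ind sum_idx)
    also have "\<dots> = (\<Sum>i=1..m+1. \<Sum>j'=1..n+1. if j' = j then \<pi> (i, j) else 0)"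
      by (intro sum.cong) auto
    finally show ?thesis using j by simp
  qed
qed

section \<open>The algorithm performs exact block updates\<close>

text \<open>The algorithm's vectors agree with exponentials only inside the index ranges; the function updates
of a time step leave arbitrary values elsewhere.\<close>
definition represents :: "(nat \<times> bool \<Rightarrow> nat \<Rightarrow> real) \<Rightarrow> (nat \<Rightarrow> nat \<Rightarrow> real) \<Rightarrow> (nat \<Rightarrow> nat \<Rightarrow> real) \<Rightarrow> bool" where
  "represents x u v \<longleftrightarrow> (\<forall>t\<in>{1..T}. (\<forall>i\<in>{1..m+1}. u t i = exp (x (t, False) i)) \<and>
      (\<forall>j\<in>{1..n+1}. v t j = exp (x (t, True) j)))"

lemma represents_kernel:
  "represents x u v \<Longrightarrow> t \<in> {1..T} \<Longrightarrow> r \<in> idx \<Longrightarrow> scaled_kernel x t r = k t r * u t (fst r) * v t (snd r)"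
  by (simp add: represents_def scaled_kernel_def pair_indices_def mem_Times_iff del: atLeastAtMost_iff)

lemma rescale_simps:
  "rescale b x b i = x b i + incr x b i"
  "b' \<noteq> b \<Longrightarrow> rescale b x b' = x b'"
  by (simp_all add: rescale_def)

lemma exp_rescale_block:
  assumes "i \<in> entry b ` row_paths"
  shows "exp (rescale b x b i) = target b i / marginal x b i * exp (x b i)"
proof -
  have "0 < target b i / marginal x b i" using target_pos[OF assms] marginal_pos[OF assms] by simp
  then show ?thesis by (simp add: rescale_simps exp_add incr_def)
qed

lemma exp_rescale:
  assumes t: "t \<in> {1..T}"
  shows "i \<in> {1..m+1} \<Longrightarrow> exp (rescale (t, False) x (t, False) i) = \<mu> i / marginal x (t, False) i * exp (x (t, False) i)"
    and "j \<in> {1..n+1} \<Longrightarrow> exp (rescale (t, True) x (t, True) j) = \<nu> j / marginal x (t, True) j * exp (x (t, True) j)"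
  by (simp_all only: exp_rescale_block entry_image[OF t] target_rows[OF t] target_columns[OF t])

text \<open>The invariant of the loop.  Here \<open>x0\<close> holds the multipliers at the start of the pass, from which the
backward messages were computed; \<open>x\<close> agrees with \<open>x0\<close> after time \<open>t\<close>.  Both the row update and the column
update change the kernel at time \<open>t\<close> only, which enters neither the forward nor the backward message at
time \<open>t\<close>, so the second update also divides by the marginal for the current multipliers.\<close>
lemma time_step_rescales:
  fixes x x0 u v u0 v0 fw
  defines "bw \<equiv> \<lambda>t. back_msg T m n k kh u0 v0 (T - t)"
  assumes t: "t \<in> {1..T}" and x0: "represents x0 u0 v0" and x: "represents x u v"
    and fw: "\<forall>r\<in>idx. fw r = forward_msg idx (scaled_kernel x) kh (t - 1) r"
    and later: "\<forall>t'>t. \<forall>b. x (t', b) = x0 (t', b)"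
    and step: "time_step T m n \<mu> \<nu> k kh bw t (u, v, fw) = (u', v', fw')"
  defines "y \<equiv> rescale (t, True) (rescale (t, False) x)"
  shows "represents y u' v'"
    and "t < T \<Longrightarrow> r \<in> idx \<Longrightarrow> fw' r = forward_msg idx (scaled_kernel y) kh t r"
proof -
  define x1 where "x1 = rescale (t, False) x"
  have y: "y = rescale (t, True) x1" by (simp add: y_def x1_def)
  have u': "u' = u(t := (\<lambda>i. \<mu> i / (\<Sum>j=1..n+1. P_mat fw (k t) (bw t) (u t) (v t) i j) * u t i))"
    and v': "v' = v(t := (\<lambda>j. \<nu> j / (\<Sum>i=1..m+1. P_mat fw (k t) (bw t) (u' t) (v t) i j) * v t j))"
    and fw': "t < T \<Longrightarrow> fw' = (\<lambda>q. \<Sum>r\<in>idx. fw r * k t r * kh r q * u' t (fst r) * v' t (snd r))"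
    using step by (auto simp: time_step_def Let_def)
  have bw_T: "\<forall>r\<in>idx. bw T r = 1" by (simp add: bw_def)
  have bw_rec: "\<forall>t'\<in>{t..<T}. \<forall>r\<in>idx. bw t' r = (\<Sum>r'\<in>idx. bw (Suc t') r' * scaled_kernel z (Suc t') r' * kh r r')"
    if z: "\<forall>t'>t. \<forall>b. z (t', b) = x0 (t', b)" for z
  proof (intro ballI)
    fix t' r assume "t' \<in> {t..<T}"
    then have "t \<le> t'" "t' < T" by auto
    then have e: "T - t' = Suc (T - Suc t')" "T - (T - Suc t') = Suc t'" by auto
    have "scaled_kernel z (Suc t') r' = k (Suc t') r' * u0 (Suc t') (fst r') * v0 (Suc t') (snd r')" if "r' \<in> idx" for r'
      using represents_kernel[OF x0 _ that, of "Suc t'"] z \<open>t \<le> t'\<close> \<open>t' < T\<close>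
      by (simp add: scaled_kernel_def)
    then show "bw t' r = (\<Sum>r'\<in>idx. bw (Suc t') r' * scaled_kernel z (Suc t') r' * kh r r')"
      unfolding bw_def e(1) back_msg.simps e(2)
      by (intro sum.cong) (simp_all add: mult_ac)
  qed
  have fw_cong: "forward_msg idx (scaled_kernel z) kh (t - 1) = forward_msg idx (scaled_kernel x) kh (t - 1)"
    if "\<And>t' b. t' < t \<Longrightarrow> z (t', b) = x (t', b)" for z
    using that by (intro forward_msg_cong) (auto simp: scaled_kernel_def)
  have x1_other: "x1 (t', b) = x (t', b)" if "t' \<noteq> t" for t' b using that by (simp add: x1_def rescale_simps)
  have y_other: "y (t', b) = x (t', b)" if "t' \<noteq> t" for t' b using that by (simp add: y rescale_simps x1_other)
  have row: "(\<Sum>j=1..n+1. P_mat fw (k t) (bw t) (u t) (v t) i j) = marginal x (t, False) i" if i: "i \<in> {1..m+1}" for i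
    unfolding marginal_by_messages(1)[OF t bw_T bw_rec[OF later] i]
    by (intro sum.cong refl) (use i t in \<open>simp add: P_mat_def fw represents_kernel[OF x] pair_indices_def\<close>)
  have x1: "represents x1 u' v"
    unfolding represents_def
  proof (intro ballI conjI)
    fix t' i assume t': "t' \<in> {1..T}"
    show "u' t' i = exp (x1 (t', False) i)" if i: "i \<in> {1..m+1}"
      using x t' i row[OF i] exp_rescale(1)[OF t i, of x] x1_other[of t' False]
      by (cases "t' = t") (auto simp: u' x1_def represents_def)
    show "v t' i = exp (x1 (t', True) i)" if "i \<in> {1..n+1}"
      using x t' that by (auto simp: x1_def represents_def rescale_simps)
  qed
  have fw1: "\<forall>r\<in>idx. fw r = forward_msg idx (scaled_kernel x1) kh (t - 1) r"
    using fw fw_cong[of x1] x1_other by simp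
  have later1: "\<forall>t'>t. \<forall>b. x1 (t', b) = x0 (t', b)"
    using x1_other later by simp
  have column: "(\<Sum>i=1..m+1. P_mat fw (k t) (bw t) (u' t) (v t) i j) = marginal x1 (t, True) j" if j: "j \<in> {1..n+1}" for j
    unfolding marginal_by_messages(2)[OF t bw_T bw_rec[OF later1] j]
    by (intro sum.cong refl) (use j t in \<open>simp add: P_mat_def fw1 represents_kernel[OF x1] pair_indices_def\<close>)
  show yr: "represents y u' v'"
    unfolding represents_def
  proof (intro ballI conjI)
    fix t' i assume t': "t' \<in> {1..T}"
    show "v' t' i = exp (y (t', True) i)" if i: "i \<in> {1..n+1}"
      using x1 t' i column[OF i] exp_rescale(2)[OF t i, of x1]
      by (cases "t' = t") (auto simp: v' y represents_def rescale_simps)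
    show "u' t' i = exp (y (t', False) i)" if "i \<in> {1..m+1}"
      using x1 t' that by (auto simp: y represents_def rescale_simps)
  qed
  show "fw' r = forward_msg idx (scaled_kernel y) kh t r" if "t < T" "r \<in> idx"
  proof -
    obtain d where d: "t = Suc d" using t by (cases t) auto
    have "fw r' = forward_msg idx (scaled_kernel y) kh d r'" if "r' \<in> idx" for r'
      using fw that fw_cong[of y] y_other d by simp
    then show ?thesis unfolding fw'[OF \<open>t < T\<close>] using d t
      by (auto simp: represents_kernel[OF yr] mult_ac intro!: sum.cong)
  qed
qed

lemma pass_rescales:
  assumes x0: "represents x0 u0 v0" and pass: "bca_pass T m n \<mu> \<nu> k kh (u0, v0) = (u1, v1)"
  shows "represents (fold rescale blocks x0) u1 v1"
proof -
  define bw where "bw = (\<lambda>t. back_msg T m n k kh u0 v0 (T - t))"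
  define run where "run d = fold (time_step T m n \<mu> \<nu> k kh bw) [1..<d+1] (u0, v0, \<lambda>_. 1)" for d
  define X where "X d = fold rescale (concat (map (\<lambda>t. [(t, False), (t, True)]) [1..<d+1])) x0" for d
  have X_Suc: "X (Suc d) = rescale (Suc d, True) (rescale (Suc d, False) (X d))" for d
    by (simp add: X_def)
  have run_Suc: "run (Suc d) = time_step T m n \<mu> \<nu> k kh bw (Suc d) (run d)" for d
    by (simp add: run_def)
  have "(\<forall>u v fw. run d = (u, v, fw) \<longrightarrow> represents (X d) u v \<and>
      (d < T \<longrightarrow> (\<forall>r\<in>idx. fw r = forward_msg idx (scaled_kernel (X d)) kh d r))) \<and>
      (\<forall>t b. d < t \<longrightarrow> X d (t, b) = x0 (t, b))" if "d \<le> T" for d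
    using that
  proof (induction d)
    case 0
    then show ?case using x0 by (auto simp: run_def X_def)
  next
    case (Suc d)
    obtain u v fw where r: "run d = (u, v, fw)" by (cases "run d")
    have IH: "represents (X d) u v" "\<forall>r\<in>idx. fw r = forward_msg idx (scaled_kernel (X d)) kh (Suc d - 1) r"
      "\<forall>t>Suc d. \<forall>b. X d (t, b) = x0 (t, b)"
      using Suc r by auto
    have "Suc d \<in> {1..T}" using Suc.prems by simp
    note step = time_step_rescales[OF this x0 IH, folded bw_def]
    show ?case
    proof (intro conjI allI impI ballI)
      fix u' v' fw' assume "run (Suc d) = (u', v', fw')"
      then have e: "time_step T m n \<mu> \<nu> k kh bw (Suc d) (u, v, fw) = (u', v', fw')" by (simp add: run_Suc r)
      show "represents (X (Suc d)) u' v'" unfolding X_Suc by (rule step(1)[OF e])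
      show "fw' r = forward_msg idx (scaled_kernel (X (Suc d))) kh (Suc d) r" if "Suc d < T" "r \<in> idx" for r
        unfolding X_Suc by (rule step(2)[OF e that])
    next
      fix t b assume "Suc d < t"
      then show "X (Suc d) (t, b) = x0 (t, b)" using IH(3) by (simp add: X_Suc rescale_simps)
    qed
  qed
  from this[of T] have "represents (X T) u v" if "run T = (u, v, fw)" for u v fw using that by auto
  moreover obtain fw where "run T = (u1, v1, fw)"
    using pass by (auto simp: bca_pass_def run_def bw_def Let_def split: prod.splits)
  ultimately show ?thesis by (simp add: X_def blocks_def)
qed

lemma iterates_represented:
  "represents ((fold rescale blocks ^^ r) (\<lambda>_ _. 0))
     (fst ((bca_pass T m n \<mu> \<nu> k kh ^^ r) (\<lambda>_ _. 1, \<lambda>_ _. 1)))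
     (snd ((bca_pass T m n \<mu> \<nu> k kh ^^ r) (\<lambda>_ _. 1, \<lambda>_ _. 1)))"
proof (induction r)
  case 0
  then show ?case by (simp add: represents_def)
next
  case (Suc r)
  show ?case using pass_rescales[OF Suc] by simp
qed

end

section \<open>The dual problem\<close>

text \<open>The excluded value \<open>- \<infinity>\<close> of a summand would break the identity, as \<open>exp_ereal\<close> is 1 at \<open>\<infinity>\<close>.\<close>
lemma exp_ereal_add:
  assumes "a \<noteq> - \<infinity>" "b \<noteq> - \<infinity>" "\<epsilon> > 0"
  shows "exp_ereal (- (a + b) / ereal \<epsilon>) = exp_ereal (- a / ereal \<epsilon>) * exp_ereal (- b / ereal \<epsilon>)"
  using assms by (cases a; cases b) (auto simp: exp_ereal_def exp_add[symmetric] diff_divide_distrib)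

lemma exp_ereal_sum:
  assumes "\<epsilon> > 0" "finite A" "\<And>i. i \<in> A \<Longrightarrow> f i \<noteq> - \<infinity>"
  shows "sum f A \<noteq> - \<infinity> \<and> exp_ereal (- sum f A / ereal \<epsilon>) = (\<Prod>i\<in>A. exp_ereal (- f i / ereal \<epsilon>))"
  using assms(2,3)
proof (induction A rule: finite_induct)
  case empty
  then show ?case by (simp add: exp_ereal_def zero_ereal_def)
next
  case (insert i A)
  then have "f i \<noteq> - \<infinity>" "sum f A \<noteq> - \<infinity>" by auto
  moreover from this have "f i + sum f A \<noteq> - \<infinity>" by (cases "f i"; cases "sum f A") auto
  ultimately show ?case using insert exp_ereal_add[OF _ _ assms(1), of "f i" "sum f A"] by simp
qed

lemma exp_ereal_real [simp]: "exp_ereal (ereal r) = exp r"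
  by (simp add: exp_ereal_def)

lemma F_cost_not_MInf: "F_cost m n p \<gamma> r r' \<noteq> - \<infinity>"
  by (cases r; cases r') simp

text \<open>The infinite transition costs turn into vanishing transition weights.\<close>
lemma exp_C_cost:
  assumes "\<epsilon> > 0"
  shows "exp_ereal (- C_cost T m n p \<gamma> c X Y s / ereal \<epsilon>)
    = chain_weight (\<lambda>t q. exp (- D_cost m n p c X Y t q / \<epsilon>))
        (\<lambda>q q'. exp_ereal (- F_cost m n p \<gamma> q q' / ereal \<epsilon>)) T s"
proof -
  let ?D = "\<lambda>t. ereal (D_cost m n p c X Y t (s t))" and ?F = "\<lambda>t. F_cost m n p \<gamma> (s t) (s (t + 1))"
  have D: "sum ?D {1..T} \<noteq> - \<infinity> \<and> exp_ereal (- sum ?D {1..T} / ereal \<epsilon>) = (\<Prod>t=1..T. exp_ereal (- ?D t / ereal \<epsilon>))"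
    by (rule exp_ereal_sum[OF assms]) simp_all
  have F: "sum ?F {1..<T} \<noteq> - \<infinity> \<and> exp_ereal (- sum ?F {1..<T} / ereal \<epsilon>) = (\<Prod>t=1..<T. exp_ereal (- ?F t / ereal \<epsilon>))"
    by (rule exp_ereal_sum[OF assms]) (rule finite_atLeastLessThan F_cost_not_MInf)+
  show ?thesis
    unfolding C_cost_def exp_ereal_add[OF conjunct1[OF D] conjunct1[OF F] assms]
      conjunct2[OF D] conjunct2[OF F]
    using assms by (simp add: chain_weight_def)
qed

lemma dual_norm_le:
  assumes "\<And>t i. t \<in> {1..T} \<Longrightarrow> i \<in> {1..m+1} \<Longrightarrow> \<bar>la t i\<bar> \<le> e"
    and "\<And>t j. t \<in> {1..T} \<Longrightarrow> j \<in> {1..n+1} \<Longrightarrow> \<bar>lb t j\<bar> \<le> e"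
    and "0 \<le> e"
  shows "dual_norm T m n la lb \<le> sqrt (real (T * (m + 1) + T * (n + 1))) * e"
proof -
  have "(\<Sum>t=1..T. \<Sum>i=1..m+1. (la t i)\<^sup>2) \<le> (\<Sum>t=1..T. \<Sum>i=1..m+1. e\<^sup>2)"
    using assms(1) by (intro sum_mono) (metis abs_ge_zero power_mono power2_abs)
  moreover have "(\<Sum>t=1..T. \<Sum>j=1..n+1. (lb t j)\<^sup>2) \<le> (\<Sum>t=1..T. \<Sum>j=1..n+1. e\<^sup>2)"
    using assms(2) by (intro sum_mono) (metis abs_ge_zero power_mono power2_abs)
  ultimately have "dual_norm T m n la lb \<le> sqrt (real (T * (m + 1) + T * (n + 1)) * e\<^sup>2)"
    unfolding dual_norm_def by (intro real_sqrt_le_mono) (simp add: algebra_simps)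
  then show ?thesis using assms(3) by (simp add: real_sqrt_mult)
qed

theorem theorem3:
  fixes T m n :: nat and p \<gamma> c \<epsilon> :: real
    and X Y :: "(real ^ 'N) trajectories"
  assumes "T \<ge> 1" and "m \<ge> 1" and "n \<ge> 1"
    and "p \<ge> 1" and "\<gamma> > 0" and "c > 0" and "\<epsilon> > 0"
  shows "\<exists>la lb A \<rho>. dual_optimal T m n p \<gamma> c \<epsilon> X Y la lb \<and> 0 \<le> A \<and> 0 \<le> \<rho> \<and> \<rho> < 1 \<and>
    (\<forall>r. dual_norm T m n
            (\<lambda>t i. bca_lambda_bar T m n p \<gamma> c \<epsilon> X Y r t i - la t i)
            (\<lambda>t j. bca_lambda_tilde T m n p \<gamma> c \<epsilon> X Y r t j - lb t j)
          \<le> A * \<rho> ^ r)"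
proof -
  define k where "k = (\<lambda>t q. exp (- D_cost m n p c X Y t q / \<epsilon>))"
  define kh where "kh = (\<lambda>q q'. exp_ereal (- F_cost m n p \<gamma> q q' / ereal \<epsilon>))"
  interpret row_preserving_chain T m n k kh
  proof
    show "kh q q' > 0" if "fst q = fst q'" for q q'
      using that \<open>\<epsilon> > 0\<close> by (cases q; cases q') (simp add: kh_def)
    show "kh q q' = 0" if "fst q \<noteq> fst q'" for q q'
      using that \<open>\<epsilon> > 0\<close> by (cases q; cases q') (simp add: kh_def exp_ereal_def)
  qed (use assms in \<open>simp_all add: k_def\<close>)
  define enc where "enc la lb = (\<lambda>(t, b) i. (if b then lb t i else la t i) / \<epsilon> :: real)"
    for la lb :: "nat \<Rightarrow> nat \<Rightarrow> real"
  have M: "M_tensor T m n p \<gamma> c \<epsilon> X Y la lb s = chain_weight (scaled_kernel (enc la lb)) kh T s" for la lb s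
    unfolding M_tensor_def exp_C_cost[OF \<open>\<epsilon> > 0\<close>] k_def[symmetric] kh_def[symmetric]
    by (simp add: chain_weight_def scaled_kernel_def enc_def prod.distrib mult_ac)
  define c0 where "c0 = \<epsilon> * real (m + 1) ^ T * real (n + 1) ^ T - \<epsilon> * (\<Sum>s\<in>row_paths. coupling s * offset s)"
  have dual: "dual_objective T m n p \<gamma> c \<epsilon> X Y la lb = c0 - \<epsilon> * potential (enc la lb)" for la lb
  proof -
    have e: "\<epsilon> * (w * enc la lb (t, False) i) = w * la t i" "\<epsilon> * (w * enc la lb (t, True) i) = w * lb t i" for w t i
      using \<open>\<epsilon> > 0\<close> by (simp_all add: enc_def)
    have L: "(\<Sum>t=1..T. \<Sum>i=1..m+1. \<mu> i * la t i) = \<epsilon> * (\<Sum>t=1..T. \<Sum>i=1..m+1. \<mu> i * enc la lb (t, False) i)"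
      "(\<Sum>t=1..T. \<Sum>j=1..n+1. \<nu> j * lb t j) = \<epsilon> * (\<Sum>t=1..T. \<Sum>j=1..n+1. \<nu> j * enc la lb (t, True) j)"
      by (simp_all only: sum_distrib_left e)
    have collect: "- \<epsilon> * S + \<epsilon> * R + \<epsilon> * Q + K = K - \<epsilon> * W - \<epsilon> * P" if "P = S - R - Q - W" for S R Q K W P :: real
      unfolding that by (simp add: algebra_simps)
    show ?thesis
      unfolding dual_objective_def M c0_def L by (rule collect[OF potential_dual])
  qed
  obtain x A \<rho> where x: "\<forall>x'. potential x \<le> potential x'" and A: "0 \<le> A" and \<rho>: "0 \<le> \<rho>" "\<rho> < 1"
    and conv: "\<forall>r. \<forall>b\<in>set blocks. \<forall>i\<in>entry b ` row_paths.
      \<bar>(fold rescale blocks ^^ r) (\<lambda>_ _. 0) b i - x b i\<bar> \<le> A * \<rho> ^ r"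
    using linear_convergence[of "\<lambda>_ _. 0"] by (elim exE conjE) (rule that)
  have conv_block: "\<bar>(fold rescale blocks ^^ r) (\<lambda>_ _. 0) b i - x b i\<bar> \<le> A * \<rho> ^ r"
    if "b \<in> set blocks" "i \<in> entry b ` row_paths" for r b i
    by (rule conv[rule_format, OF that])
  define la where "la t i = \<epsilon> * x (t, False) i" for t i
  define lb where "lb t j = \<epsilon> * x (t, True) j" for t j
  have enc: "enc la lb = x"
    using \<open>\<epsilon> > 0\<close> by (auto simp: enc_def la_def lb_def fun_eq_iff)
  have "dual_optimal T m n p \<gamma> c \<epsilon> X Y la lb"
    unfolding dual_optimal_def dual enc using x \<open>\<epsilon> > 0\<close> by simp
  moreover have "dual_norm T m n
            (\<lambda>t i. bca_lambda_bar T m n p \<gamma> c \<epsilon> X Y r t i - la t i)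
            (\<lambda>t j. bca_lambda_tilde T m n p \<gamma> c \<epsilon> X Y r t j - lb t j)
          \<le> (sqrt (real (T * (m + 1) + T * (n + 1))) * (\<epsilon> * A)) * \<rho> ^ r" for r
  proof -
    let ?x = "(fold rescale blocks ^^ r) (\<lambda>_ _. 0)"
    have rep: "represents ?x (fst (bca_iterate T m n p \<gamma> c \<epsilon> X Y r)) (snd (bca_iterate T m n p \<gamma> c \<epsilon> X Y r))"
      unfolding bca_iterate_def k_def[symmetric] kh_def[symmetric] by (rule iterates_represented)
    have "\<bar>bca_lambda_bar T m n p \<gamma> c \<epsilon> X Y r t i - la t i\<bar> \<le> \<epsilon> * (A * \<rho> ^ r)"
      if t: "t \<in> {1..T}" and i: "i \<in> {1..m+1}" for t i
    proof -
      have "bca_lambda_bar T m n p \<gamma> c \<epsilon> X Y r t i - la t i = \<epsilon> * (?x (t, False) i - x (t, False) i)"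
        using rep t i by (simp add: bca_lambda_bar_def la_def represents_def right_diff_distrib)
      moreover have "\<bar>?x (t, False) i - x (t, False) i\<bar> \<le> A * \<rho> ^ r"
        by (rule conv_block) (use t i in \<open>simp_all only: set_blocks entry_image(1)[OF t] mem_Times_iff fst_conv UNIV_I\<close>)
      ultimately show ?thesis using \<open>\<epsilon> > 0\<close> by (simp add: abs_mult)
    qed
    moreover have "\<bar>bca_lambda_tilde T m n p \<gamma> c \<epsilon> X Y r t j - lb t j\<bar> \<le> \<epsilon> * (A * \<rho> ^ r)"
      if t: "t \<in> {1..T}" and j: "j \<in> {1..n+1}" for t j
    proof -
      have "bca_lambda_tilde T m n p \<gamma> c \<epsilon> X Y r t j - lb t j = \<epsilon> * (?x (t, True) j - x (t, True) j)"
        using rep t j by (simp add: bca_lambda_tilde_def lb_def represents_def right_diff_distrib)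
      moreover have "\<bar>?x (t, True) j - x (t, True) j\<bar> \<le> A * \<rho> ^ r"
        by (rule conv_block) (use t j in \<open>simp_all only: set_blocks entry_image(2)[OF t] mem_Times_iff fst_conv UNIV_I\<close>)
      ultimately show ?thesis using \<open>\<epsilon> > 0\<close> by (simp add: abs_mult)
    qed
    moreover have "0 \<le> \<epsilon> * (A * \<rho> ^ r)" using A \<rho> \<open>\<epsilon> > 0\<close> by simp
    ultimately show ?thesis using dual_norm_le[of T m _ "\<epsilon> * (A * \<rho> ^ r)" n] by (simp add: mult.assoc)
  qed
  moreover have "0 \<le> sqrt (real (T * (m + 1) + T * (n + 1))) * (\<epsilon> * A)" using A \<open>\<epsilon> > 0\<close> by simp
  ultimately show ?thesis using \<rho> by blast
qed

end
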